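(* Let $\prec$ be a well-order on $\mathbb{N}$ with order type $|{\prec}|$, let $k\ge1$ and let $h>0$ be a natural number. If $|{\prec}|>2_k(\omega^{h+1})\cdot2+\omega$, then Delayer has a winning strategy for the game $\mathcal{G}_{k+1}(\prec,h)$. Here $2_0(\alpha)=\alpha$ and $2_{j+1}(\alpha)=2^{2_j(\alpha)}$ (ordinal exponentiation).
   Context: **Trees.** $\omega^{<\omega}$ is the set of finite sequences of natural numbers, $*$ is concatenation ($\sigma*k$ appends the number $k$), $\subseteq$ is the initial segment relation and $\subsetneq$ its proper version. A rooted tree is a nonempty subset of $\omega^{<\omega}$ closed under initial segments; $\sigma*k$ is a child of its parent $\sigma$; leaves are nodes without children; the height of a node is its length and the height of a finite tree is the maximum height of its nodes. A comb of height $\le h$ is a finite rooted tree $T$ of height $\le h$ such that the children of each non-leaf $\sigma$ are the $\sigma*i$ with $i$ in a nonempty interval of consecutive natural numbers, and, with $c(T)$ denoting the lexicographically least (leftmost) leaf, every parent of a leaf is a proper initial segment of $c(T)$. $\mathcal{R}$ is the set of finite partial predicates, i.e. functions from a finite subset of $\mathbb{N}$ to $\{0,1\}$. **The games.** Fix $\prec$ and $h$. All games $\mathcal{G}_k=\mathcal{G}_k(\prec,h)$, $k\ge1$, are played by Prover and Delayer. Call $\rho'\in\mathcal{R}$ a legal answer to a finite set $Q\subseteq\mathbb{N}$ if $Q\subseteq\mathrm{dom}(\rho')$ and for every $q\in Q$ with $\rho'(q)=1$ there is $p\prec q$ with $\rho'(p)=1$. Inductively we define the set $\mathcal{P}_k$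 of possible positions of $\mathcal{G}_k$, the data $\rho(P)\in\mathcal{R}$ of a position $P$, the (partially defined) next position of $P$ along $Q,\rho',\langle o,b\rangle$, and the set $\mathcal{S}_k$ of plays. Level 1: $\mathcal{P}_1$ is the set of pairs $P=(T,\rho)$ with $T$ a comb of height $\le h$ and $\rho\in\mathcal{R}$; $\rho(P)=\rho$. The next position of $(T,\rho)$ along $Q,\rho',\langle o,b\rangle$ is defined only if $\rho\cup\rho'$ is a function and is then as follows. If $o=0$ (and $b\in\omega$): let $T'=T\cup\{c(T)*i\mid0\le i\le b\}$; the next position is $(T',\rho\cup\rho')$ if $T'$ has height $\le h$, and does not exist otherwise. If $o=1$ (and $b\in\omega^{<\omega}$, $b\subsetneq c(T)$): write $c(T)=b*k*\sigma$ with $k\in\omega$; the next position is $(T\setminus\{b*k*\tau\mid\tau\in\omega^{<\omega}\},\rho\cup\rho')$ if $b*(k+1)\in T$, and does not exist otherwise. Level $k+1$ ($k\ge1$): $\mathcal{P}_{k+1}$ is the set of all nonempty subsequences of sequences in $\mathcal{S}_k$. For $P=(P_0,\dots,P_l)\in\mathcal{P}_{k+1}$ put $\rho(P)=\rho(P_l)$. The next position of $P$ along $Q,\rho',\langle o,b\rangle$ is: if $o\in[0,k]$, $(P_0,\dots,P_l,P_{l+1})$ where $P_{l+1}$ is the next position of $P_l$ in $\mathcal{G}_k$ along $Q,\rho',\langle o,b\rangle$ (nonexistent if there is no such $P_{l+1}$); if $o=k+1$ (and $b\in\omega$), $(P_0,\dots,P_{b-1},Q_b)$ where $b\le l$ and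 $Q_b$ is the next position of $P_b$ in $\mathcal{G}_k$ along $Q,\rho',\langle0,0\rangle$ (nonexistent if $b\ge l+1$ or there is no such $Q_b$). Play of $\mathcal{G}_k$: Delayer chooses $m_0\in\mathbb{N}$; the initial position is $P^{(k)}_0$ where $P^{(1)}_0=(\{\emptyset\},\{m_0\mapsto1\})$ and $P^{(j+1)}_0=(P^{(j)}_0)$ (a one-term sequence). At position $P$: Prover plays a finite $Q\subseteq\mathbb{N}$; Delayer plays a legal answer $\rho'$ to $Q$; if $\rho(P)\cup\rho'$ is not a function, the play ends and Prover wins; otherwise Prover plays $\langle o,b\rangle$ with $o\in[0,k]$ and $b\in\omega^{<\omega}$, where $b$ must be a number if $o\ne1$; if the next position of $P$ along $Q,\rho',\langle o,b\rangle$ does not exist, the play ends and Prover loses (Delayer wins); otherwise the game continues from it. $\mathcal{S}_k$ is the set of all finite sequences of positions generated in this way, starting from an initial position. Strategies may depend on the whole history; a winning strategy is one that wins against every strategy of the opponent. *)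

theory Defs
  imports Main "HOL-Library.Sublist" "HOL-Library.List_Lexorder" "HOL-Library.Countable_Set"
begin

section \<open>Ordinals\<close>

text \<open>
  Ordinals are represented by (reflexive) well-order relations and compared by the library's
  \<open><o\<close> and \<open>=o\<close>, so \<open>natLeq\<close> is \<open>\<omega>\<close> and \<open>natLeq_on n\<close> is \<open>n\<close>. Sum, product and power are the
  usual order-theoretic ones: in a product the second factor is the more significant one, and a
  power is the set of functions of finite support, compared at the largest argument where they
  differ.
\<close>

unbundle cardinal_syntax

definition osum :: "'a rel \<Rightarrow> 'b rel \<Rightarrow> ('a + 'b) rel" where
  "osum r s = {(Inl a, Inl a') | a a'. (a, a') \<in> r} \<union> {(Inr b, Inr b') | b b'. (b, b') \<in> s} \<union>
     {(Inl a, Inr b) | a b. a \<in> Field r \<and> b \<in> Field s}"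

definition oprod :: "'a rel \<Rightarrow> 'b rel \<Rightarrow> ('a \<times> 'b) rel" where
  "oprod r s = {((a, b), (a', b')). a \<in> Field r \<and> a' \<in> Field r \<and> b \<in> Field s \<and> b' \<in> Field s \<and>
     (b \<noteq> b' \<and> (b, b') \<in> s \<or> b = b' \<and> (a, a') \<in> r)}"

definition fin_supp_funcs :: "'a rel \<Rightarrow> 'b rel \<Rightarrow> ('b \<Rightarrow> 'a) set" where
  "fin_supp_funcs r s =
     {f \<in> Func (Field s) (Field r). finite {x \<in> Field s. f x \<noteq> wo_rel.minim r (Field r)}}"

definition oexp :: "'a rel \<Rightarrow> 'b rel \<Rightarrow> ('b \<Rightarrow> 'a) rel" where
  "oexp r s = {(f, g). f \<in> fin_supp_funcs r s \<and> g \<in> fin_supp_funcs r s \<and>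
     (f = g \<or> (\<exists>m\<in>Field s. f m \<noteq> g m \<and> (f m, g m) \<in> r \<and>
        (\<forall>x\<in>Field s. (m, x) \<in> s \<and> x \<noteq> m \<longrightarrow> f x = g x)))}"

text \<open>
  \<open>oexp\<close> raises the type, so it cannot be iterated a variable number of times as it stands. All
  ordinals needed here are countable, and \<open>on_nat r\<close> is a copy of the countable well-order \<open>r\<close>
  whose elements are natural numbers. Then \<open>tower j r\<close> is \<open>2\<^sub>j(r)\<close>.
\<close>

definition on_nat :: "'a rel \<Rightarrow> nat rel" where
  "on_nat r = dir_image r (SOME f. inj_on f (Field r))"

lemma on_nat_ordIso:
  assumes "Well_order r" "countable (Field r)"
  shows "r =o on_nat r"
proof -
  have "\<exists>f :: _ \<Rightarrow> nat. inj_on f (Field r)"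
    using assms(2) by (auto simp: countable_def)
  then have "inj_on (SOME f :: _ \<Rightarrow> nat. inj_on f (Field r)) (Field r)"
    by (rule someI_ex)
  then show ?thesis
    unfolding on_nat_def using assms(1) by (rule dir_image_ordIso[rotated])
qed

primrec tower :: "nat \<Rightarrow> nat rel \<Rightarrow> nat rel" where
  "tower 0 r = r"
| "tower (Suc j) r = on_nat (oexp (natLeq_on 2) (tower j r))"


section \<open>Combs\<close>

definition rooted_tree :: "nat list set \<Rightarrow> bool" where
  "rooted_tree T \<longleftrightarrow> T \<noteq> {} \<and> (\<forall>\<sigma>\<in>T. \<forall>\<tau>. prefix \<tau> \<sigma> \<longrightarrow> \<tau> \<in> T)"

definition leaf :: "nat list set \<Rightarrow> nat list \<Rightarrow> bool" where
  "leaf T \<sigma> \<longleftrightarrow> \<sigma> \<in> T \<and> (\<forall>i. \<sigma> @ [i] \<notin> T)"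

definition height :: "nat list set \<Rightarrow> nat" where
  "height T = Max (length ` T)"

text \<open>The order on \<^typ>\<open>nat list\<close> is the lexicographic one.\<close>

definition leftmost_leaf :: "nat list set \<Rightarrow> nat list" where
  "leftmost_leaf T = Min {\<sigma>. leaf T \<sigma>}"

definition comb :: "nat \<Rightarrow> nat list set \<Rightarrow> bool" where
  "comb h T \<longleftrightarrow> finite T \<and> rooted_tree T \<and> height T \<le> h \<and>
     (\<forall>\<sigma>\<in>T. \<not> leaf T \<sigma> \<longrightarrow> (\<exists>a b. a \<le> b \<and> {i. \<sigma> @ [i] \<in> T} = {a..b})) \<and>
     (\<forall>\<sigma> i. leaf T (\<sigma> @ [i]) \<longrightarrow> strict_prefix \<sigma> (leftmost_leaf T))"


section \<open>Positions and moves\<close>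

text \<open>
  A (finite) partial predicate is a (finite) partial map to \<^typ>\<open>bool\<close>; \<^const>\<open>True\<close> is the
  value 1. The union of two of them is a function iff they are compatible, and is then \<open>++\<close>.
\<close>

type_synonym partial_pred = "nat \<rightharpoonup> bool"

definition compatible :: "partial_pred \<Rightarrow> partial_pred \<Rightarrow> bool" where
  "compatible \<rho> \<rho>' \<longleftrightarrow> (\<forall>x \<in> dom \<rho> \<inter> dom \<rho>'. \<rho> x = \<rho>' x)"

definition legal_answer :: "nat rel \<Rightarrow> nat set \<Rightarrow> partial_pred \<Rightarrow> bool" where
  "legal_answer prec Q \<rho>' \<longleftrightarrow> finite (dom \<rho>') \<and> Q \<subseteq> dom \<rho>' \<and>
     (\<forall>q\<in>Q. \<rho>' q = Some True \<longrightarrow> (\<exists>p. (p, q) \<in> prec \<and> p \<noteq> q \<and> \<rho>' p = Some True))"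

text \<open>
  In a move \<open>\<langle>o, b\<rangle>\<close> the second component is a finite sequence, a number \<open>n\<close> being the one-term
  sequence \<open>[n]\<close>.
\<close>

type_synonym move = "nat \<times> nat list"

definition legal_move :: "nat \<Rightarrow> move \<Rightarrow> bool" where
  "legal_move k = (\<lambda>(c, b). c \<le> k \<and> (c \<noteq> 1 \<longrightarrow> length b = 1))"

text \<open>
  \<open>Base\<close> is for the positions of the first game, \<open>Seq\<close> for those of the higher ones. This type is
  a common superset of the sets of positions of all games; see \<open>positions\<close> below.
\<close>

datatype position = Base "nat list set" partial_pred | Seq "position list"

lemma size_last_less [termination_simp]:
  "Ps \<noteq> [] \<Longrightarrow> size (last Ps) < Suc (size_list size Ps)"
  by (rule le_imp_less_Suc, rule size_list_estimation'[OF last_in_set]) simp_all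

fun rho :: "position \<Rightarrow> partial_pred" where
  "rho (Base T \<rho>) = \<rho>"
| "rho (Seq Ps) = (if Ps = [] then Map.empty else rho (last Ps))"

primrec init_pos :: "nat \<Rightarrow> nat \<Rightarrow> position" where
  "init_pos 0 m = undefined"
| "init_pos (Suc j) m = (if j = 0 then Base {[]} [m \<mapsto> True] else Seq [init_pos j m])"

definition next_base ::
  "nat \<Rightarrow> nat list set \<Rightarrow> partial_pred \<Rightarrow> partial_pred \<Rightarrow> move \<Rightarrow> position option" where
  "next_base h T \<rho> \<rho>' = (\<lambda>(c, b).
     let \<gamma> = leftmost_leaf T in
     if \<not> compatible \<rho> \<rho>' then None
     else if c = 0 then
       (let T' = T \<union> {\<gamma> @ [i] | i. i \<le> hd b}
        in if height T' \<le> h then Some (Base T' (\<rho> ++ \<rho>')) else None)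
     else if c = 1 \<and> strict_prefix b \<gamma> then
       (let j = \<gamma> ! length b
        in if b @ [Suc j] \<in> T
           then Some (Base (T - {b @ [j] @ \<tau> | \<tau>. True}) (\<rho> ++ \<rho>')) else None)
     else None)"

text \<open>
  The next position in the \<open>k\<close>-th game along \<open>Q, \<rho>', \<langle>o, b\<rangle>\<close>; it does not depend on \<open>Q\<close>.
\<close>

fun next_pos ::
  "nat \<Rightarrow> nat \<Rightarrow> position \<Rightarrow> partial_pred \<Rightarrow> move \<Rightarrow> position option" where
  "next_pos h (Suc 0) (Base T \<rho>) \<rho>' mv = next_base h T \<rho> \<rho>' mv"
| "next_pos h (Suc (Suc k)) (Seq Ps) \<rho>' (c, b) =
     (if c \<le> Suc k then
        map_option (\<lambda>P. Seq (Ps @ [P])) (next_pos h (Suc k) (last Ps) \<rho>' (c, b))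
      else if c = Suc (Suc k) \<and> hd b < length Ps then
        map_option (\<lambda>P. Seq (take (hd b) Ps @ [P]))
          (next_pos h (Suc k) (Ps ! hd b) \<rho>' (0, [0]))
      else None)"
| "next_pos _ _ _ _ _ = None"

text \<open>
  \<open>plays prec h k\<close> and \<open>positions prec h k\<close> are the sets of plays and of possible positions of the
  \<open>k\<close>-th game.
\<close>

inductive_set plays :: "nat rel \<Rightarrow> nat \<Rightarrow> nat \<Rightarrow> position list set" for prec h k where
  init: "[init_pos k m] \<in> plays prec h k"
| step: "\<lbrakk>ps \<in> plays prec h k; finite Q; legal_answer prec Q \<rho>'; compatible (rho (last ps)) \<rho>';
    legal_move k mv; next_pos h k (last ps) \<rho>' mv = Some P\<rbrakk> \<Longrightarrow> ps @ [P] \<in> plays prec h k"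

fun positions :: "nat rel \<Rightarrow> nat \<Rightarrow> nat \<Rightarrow> position set" where
  "positions prec h 0 = {}"
| "positions prec h (Suc 0) = {Base T \<rho> | T \<rho>. comb h T \<and> finite (dom \<rho>)}"
| "positions prec h (Suc (Suc k)) = {Seq Ps | Ps. Ps \<noteq> [] \<and> (\<exists>ps \<in> plays prec h (Suc k). subseq Ps ps)}"


section \<open>Strategies\<close>

text \<open>
  The history lists the completed rounds, i.e. Prover's query, Delayer's answer and Prover's move;
  together with Delayer's initial choice \<open>m\<close> it determines all positions so far. Delayer's strategy
  consists of \<open>m\<close> and of \<open>answ\<close>; Prover's strategy consists of \<open>query\<close> and \<open>pick\<close>.
\<close>

type_synonym history = "(nat set \<times> partial_pred \<times> move) list"

datatype status = Running history position | Prover_Won | Delayer_Won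

primrec run :: "nat \<Rightarrow> nat \<Rightarrow> nat \<Rightarrow> (history \<Rightarrow> nat set \<Rightarrow> partial_pred) \<Rightarrow>
    (nat \<Rightarrow> history \<Rightarrow> nat set) \<Rightarrow> (nat \<Rightarrow> history \<Rightarrow> partial_pred \<Rightarrow> move) \<Rightarrow> nat \<Rightarrow> status" where
  "run h k m answ query pick 0 = Running [] (init_pos k m)"
| "run h k m answ query pick (Suc n) =
    (case run h k m answ query pick n of
       Running hs P \<Rightarrow>
         (let Q = query m hs; \<rho>' = answ hs Q; mv = pick m hs \<rho>' in
          if \<not> compatible (rho P) \<rho>' then Prover_Won
          else (case next_pos h k P \<rho>' mv of
                  None \<Rightarrow> Delayer_Won
                | Some P' \<Rightarrow> Running (hs @ [(Q, \<rho>', mv)]) P'))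
     | Prover_Won \<Rightarrow> Prover_Won
     | Delayer_Won \<Rightarrow> Delayer_Won)"

definition delayer_strategy :: "nat rel \<Rightarrow> (history \<Rightarrow> nat set \<Rightarrow> partial_pred) \<Rightarrow> bool" where
  "delayer_strategy prec answ \<longleftrightarrow> (\<forall>hs Q. finite Q \<longrightarrow> legal_answer prec Q (answ hs Q))"

definition prover_strategy ::
  "nat \<Rightarrow> (nat \<Rightarrow> history \<Rightarrow> nat set) \<Rightarrow> (nat \<Rightarrow> history \<Rightarrow> partial_pred \<Rightarrow> move) \<Rightarrow> bool" where
  "prover_strategy k query pick \<longleftrightarrow>
     (\<forall>m hs. finite (query m hs)) \<and> (\<forall>m hs \<rho>'. legal_move k (pick m hs \<rho>'))"

text \<open>To win, Delayer has to bring the play to an end; an infinite play would not count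
  (there is none: every move decreases a suitable ordinal measure of the position).\<close>

definition delayer_winning_strategy ::
  "nat rel \<Rightarrow> nat \<Rightarrow> nat \<Rightarrow> nat \<Rightarrow> (history \<Rightarrow> nat set \<Rightarrow> partial_pred) \<Rightarrow> bool" where
  "delayer_winning_strategy prec h k m answ \<longleftrightarrow> delayer_strategy prec answ \<and>
     (\<forall>query pick. prover_strategy k query pick \<longrightarrow>
        (\<exists>n. run h k m answ query pick n = Delayer_Won))"


section \<open>Runs stay within the possible positions\<close>

text \<open>
  \<open>next_pos\<close> is defined on the whole type of positions. The lemmas below show that a run only ever
  visits elements of \<open>positions prec h k\<close>, so the extra values do not affect the game.
\<close>


lemma leaf_above:
  assumes "finite T" "\<sigma> \<in> T" shows "\<exists>\<tau>. leaf T \<tau> \<and> prefix \<sigma> \<tau>"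
proof -
  define S where "S = {\<tau> \<in> T. prefix \<sigma> \<tau>}"
  have fin: "finite S" unfolding S_def by (rule finite_subset[OF _ assms(1)]) blast
  have "\<sigma> \<in> S" using assms(2) by (simp add: S_def)
  then have "Max (length ` S) \<in> length ` S" using fin by (intro Max_in) auto
  then obtain \<tau> where t: "\<tau> \<in> S" "length \<tau> = Max (length ` S)" by (metis imageE)
  have t1: "length x \<le> length \<tau>" if "x \<in> S" for x
    unfolding t(2) by (rule Max_ge) (use fin that in auto)
  have "\<tau> @ [i] \<notin> T" for i using t(1) t1[of "\<tau> @ [i]"] by (auto simp: S_def)
  then show ?thesis using t(1) by (auto simp: leaf_def S_def)
qed

lemma finite_leaves: "finite T \<Longrightarrow> finite {\<sigma>. leaf T \<sigma>}"
  by (erule finite_subset[rotated]) (auto simp: leaf_def)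

lemma leftmost: assumes "finite T" "rooted_tree T"
  shows "leaf T (leftmost_leaf T)" "leaf T x \<Longrightarrow> leftmost_leaf T \<le> x"
proof -
  have "{\<sigma>. leaf T \<sigma>} \<noteq> {}" using leaf_above assms by (fastforce simp: rooted_tree_def)
  from Min_in[OF finite_leaves[OF assms(1)] this] show "leaf T (leftmost_leaf T)"
    by (simp add: leftmost_leaf_def)
  show "leaf T x \<Longrightarrow> leftmost_leaf T \<le> x"
    using finite_leaves[OF assms(1)] by (simp add: leftmost_leaf_def)
qed

lemma leftmostI: assumes "finite T" "leaf T c" "\<And>x. leaf T x \<Longrightarrow> c \<le> x"
  shows "leftmost_leaf T = c"
  unfolding leftmost_leaf_def by (rule Min_eqI) (use assms finite_leaves in auto)

lemma leaf_prefix: assumes "rooted_tree T" "leaf T x" "y \<in> T" "prefix x y" shows "x = y"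
proof (rule ccontr)
  assume "x \<noteq> y"
  then obtain z zs where "y = x @ z # zs" using assms(4) by (metis append_Nil2 neq_Nil_conv prefix_def)
  then have "prefix (x @ [z]) y" by simp
  then show False using assms unfolding rooted_tree_def leaf_def by blast
qed

lemma less_split: "(x :: nat list) < y \<Longrightarrow> \<not> prefix x y \<Longrightarrow> \<exists>u a b v w. a < b \<and> x = u @ a # v \<and> y = u @ b # w"
  unfolding list_less_def lexord_def by (auto simp: prefix_def)

lemma split_less: "(a::nat) < b \<Longrightarrow> u @ a # v < u @ b # w"
  unfolding list_less_def lexord_def by blast

lemma comb_extend:
  assumes T: "comb h T" and h: "height (T \<union> {leftmost_leaf T @ [i] | i. i \<le> b}) \<le> h"
  shows "comb h (T \<union> {leftmost_leaf T @ [i] | i. i \<le> (b::nat)})"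
proof -
  define c where "c = leftmost_leaf T"
  define T' where "T' = T \<union> {c @ [i] | i. i \<le> b}"
  have fin: "finite T" and rt: "rooted_tree T" using T by (auto simp: comb_def)
  note c = leftmost[OF fin rt, folded c_def]
  have cT: "c \<in> T" "\<And>i. c @ [i] \<notin> T" using c by (auto simp: leaf_def)
  have fin': "finite T'" using fin by (auto simp: T'_def)
  have rt': "rooted_tree T'" using rt cT unfolding rooted_tree_def T'_def
    by (auto simp: prefix_snoc)
  have lf1: "leaf T' (c @ [i])" if "i \<le> b" for i
    using that rt cT unfolding leaf_def T'_def rooted_tree_def by (auto) (metis append_assoc append_Cons append_Nil cT(2) prefixI)
  have lf2: "leaf T x \<and> x \<noteq> c \<or> (\<exists>i\<le>b. x = c @ [i])" if "leaf T' x" for x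
  proof -
    have "c @ [0] \<in> T'" by (auto simp: T'_def)
    then show ?thesis using that by (auto simp: leaf_def T'_def)
  qed
  have lc: "leftmost_leaf T' = c @ [0]"
  proof (rule leftmostI[OF fin'])
    show "leaf T' (c @ [0])" using lf1 by simp
    fix x assume "leaf T' x"
    from lf2[OF this] show "c @ [0] \<le> x"
    proof
      assume x: "leaf T x \<and> x \<noteq> c"
      then have "c < x" "\<not> prefix c x" using c(2)[of x] leaf_prefix[OF rt c(1), of x]
        by (auto simp: leaf_def)
      from less_split[OF this] obtain u a d v w where "a < d" "c = u @ a # v" "x = u @ d # w" by blast
      then have "c @ [0] < x" using split_less[of a d u "v @ [0]" w] by simp
      then show ?thesis by simp
    next
      assume "\<exists>i\<le>b. x = c @ [i]"
      then obtain i where "x = c @ [i]" by blast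
      then show ?thesis using split_less[of 0 i c "[]" "[]"] by (cases "i = 0") auto
    qed
  qed
  have ch: "\<exists>a d. a \<le> d \<and> {i. \<sigma> @ [i] \<in> T'} = {a..d}" if "\<sigma> \<in> T'" "\<not> leaf T' \<sigma>" for \<sigma>
  proof (cases "\<sigma> = c")
    case True
    then have "{i. \<sigma> @ [i] \<in> T'} = {0..b}" using cT by (auto simp: T'_def)
    then show ?thesis by blast
  next
    case False
    then have "\<sigma> \<in> T" using that lf1 by (auto simp: T'_def)
    moreover have *: "{i. \<sigma> @ [i] \<in> T'} = {i. \<sigma> @ [i] \<in> T}" using False by (auto simp: T'_def)
    moreover have "\<not> leaf T \<sigma>" using that * \<open>\<sigma> \<in> T\<close> by (auto simp: leaf_def)
    ultimately show ?thesis using T unfolding comb_def by metis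
  qed
  have pl: "strict_prefix \<sigma> (leftmost_leaf T')" if "leaf T' (\<sigma> @ [i])" for \<sigma> i
    using lf2[OF that]
  proof
    assume "leaf T (\<sigma> @ [i]) \<and> \<sigma> @ [i] \<noteq> c"
    then have "strict_prefix \<sigma> c" using T unfolding comb_def c_def by blast
    then show ?thesis unfolding lc by (metis append_Nil2 prefix_order.less_le_trans prefixI)
  qed (auto simp: lc strict_prefix_def)
  show ?thesis unfolding comb_def
    using fin' rt' h ch pl unfolding T'_def c_def by blast
qed

lemma height_mono: "finite T \<Longrightarrow> S \<subseteq> T \<Longrightarrow> S \<noteq> {} \<Longrightarrow> height S \<le> height T"
  unfolding height_def by (rule Max_mono) auto

lemma comb_cut:
  assumes T: "comb h T" and c: "leftmost_leaf T = b @ j # s" and bs: "b @ [Suc j] \<in> T"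
  shows "comb h (T - {b @ [j] @ \<tau> | \<tau>. True})"
proof -
  define T' where "T' = T - {b @ [j] @ \<tau> | \<tau>. True}"
  define c where "c = leftmost_leaf T"
  note c2 = c[folded c_def]
  have fin: "finite T" and rt: "rooted_tree T" using T by (auto simp: comb_def)
  note cl = leftmost[OF fin rt, folded c_def]
  have T'_iff: "x \<in> T' \<longleftrightarrow> x \<in> T \<and> \<not> prefix (b @ [j]) x" for x by (auto simp: T'_def prefix_def)
  have fin': "finite T'" using fin by (auto simp: T'_def)
  have bs': "b @ [Suc j] \<in> T'" using bs by (auto simp: T'_iff)
  have rt': "rooted_tree T'" unfolding rooted_tree_def
  proof (intro conjI ballI allI impI)
    show "T' \<noteq> {}" using bs' by auto
    fix x y assume "x \<in> T'" "prefix y x"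
    then show "y \<in> T'" using rt unfolding T'_iff rooted_tree_def by (meson prefix_order.trans)
  qed
  have par: "strict_prefix \<sigma> c" if "leaf T (\<sigma> @ [i])" for \<sigma> i
    using T that unfolding comb_def c_def by blast
  have lbs: "leaf T (b @ [Suc j])"
  proof -
    obtain l where l: "leaf T l" "prefix (b @ [Suc j]) l" using leaf_above[OF fin bs] by blast
    show ?thesis
    proof (cases "l = b @ [Suc j]")
      case False
      then obtain \<mu> i where "l = \<mu> @ [i]" "prefix (b @ [Suc j]) \<mu>"
        using l(2) by (cases l rule: rev_cases) (auto simp: prefix_snoc)
      then have "prefix (b @ [Suc j]) c" using par[of \<mu> i] l by (meson prefix_order.trans strict_prefix_def)
      then show ?thesis by (simp add: c2)
    qed (use l in simp)
  qed
  have lf: "leaf T' x \<longleftrightarrow> leaf T x \<and> x \<in> T'" for x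
  proof
    assume x: "leaf T' x"
    then have "x \<in> T'" by (auto simp: leaf_def)
    moreover have "x @ [i] \<notin> T" for i
    proof
      assume "x @ [i] \<in> T"
      moreover have "x @ [i] \<notin> T'" using x by (auto simp: leaf_def)
      ultimately have "x = b" using \<open>x \<in> T'\<close> by (auto simp: T'_iff prefix_snoc)
      then show False using x bs' by (auto simp: leaf_def)
    qed
    ultimately show "leaf T x \<and> x \<in> T'" by (auto simp: leaf_def T'_iff)
  next
    assume "leaf T x \<and> x \<in> T'" then show "leaf T' x" by (auto simp: leaf_def T'_iff)
  qed
  have lc: "leftmost_leaf T' = b @ [Suc j]"
  proof (rule leftmostI[OF fin'])
    show "leaf T' (b @ [Suc j])" using lbs lf bs' by simp
    fix x assume "leaf T' x"
    then have x: "leaf T x" "x \<in> T'" using lf by auto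
    have "x \<noteq> c" using x(2) by (auto simp: c2 T'_iff)
    then have "c < x" "\<not> prefix c x" using cl(2)[of x] leaf_prefix[OF rt cl(1), of x] x
      by (auto simp: leaf_def)
    from less_split[OF this] obtain u a d v w where u: "a < d" "c = u @ a # v" "x = u @ d # w" by blast
    have "u @ a # v = b @ j # s" using u c2 by simp
    then consider z where "b = u @ a # z" | "u = b" "a = j" | z where "u = b @ j # z"
      by (auto simp: append_eq_append_conv2 Cons_eq_append_conv append_eq_Cons_conv)
    then show "b @ [Suc j] \<le> x"
    proof cases
      case 1 then show ?thesis using split_less[of a d u "z @ [Suc j]" w] u by (simp add: less_imp_le)
    next
      case 2
      show ?thesis
      proof (cases "d = Suc j")
        case True
        then have "prefix (b @ [Suc j]) x" using u 2 by simp
        then have "b @ [Suc j] = x" using leaf_prefix[OF rt lbs] x by (auto simp: leaf_def)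
        then show ?thesis by simp
      next
        case False
        then show ?thesis using split_less[of "Suc j" d b "[]" w] u 2 by (simp add: less_imp_le)
      qed
    next
      case 3 then show ?thesis using u x by (auto simp: T'_iff)
    qed
  qed
  have jmin: "j \<le> i" if "b @ [i] \<in> T" for i
  proof (rule ccontr)
    assume "\<not> j \<le> i"
    obtain l where l: "leaf T l" "prefix (b @ [i]) l" using leaf_above[OF fin \<open>b @ [i] \<in> T\<close>] by blast
    then obtain r where "l = b @ i # r" by (auto simp: prefix_def)
    then have "l < c" using split_less[of i j b r s] \<open>\<not> j \<le> i\<close> by (simp add: c2)
    then show False using cl(2)[OF l(1)] by simp
  qed
  have ch: "\<exists>a d. a \<le> d \<and> {i. \<sigma> @ [i] \<in> T'} = {a..d}" if s: "\<sigma> \<in> T'" "\<not> leaf T' \<sigma>" for \<sigma>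
  proof -
    have s': "\<sigma> \<in> T" "\<not> leaf T \<sigma>" using s lf by (auto simp: T'_iff)
    then obtain a d where ad: "a \<le> d" "{i. \<sigma> @ [i] \<in> T} = {a..d}" using T unfolding comb_def by blast
    show ?thesis
    proof (cases "\<sigma> = b")
      case True
      have "prefix (b @ [j]) c" "c \<in> T" using c2 cl by (auto simp: leaf_def)
      then have bj: "b @ [j] \<in> T" using rt unfolding rooted_tree_def by blast
      have "{i. \<sigma> @ [i] \<in> T'} = {a..d} - {j}" using ad True by (auto simp: T'_iff)
      moreover have "j \<in> {a..d}" "Suc j \<in> {a..d}" "\<And>i. i \<in> {a..d} \<Longrightarrow> j \<le> i"
        using ad(2)[symmetric] True bs jmin bj by auto
      ultimately have "{i. \<sigma> @ [i] \<in> T'} = {Suc j..d}" "Suc j \<le> d" 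
        by (auto simp: set_eq_iff Suc_le_eq order_less_le)
      then show ?thesis by blast
    next
      case False
      then have "{i. \<sigma> @ [i] \<in> T'} = {a..d}" using ad s(1) by (auto simp: T'_iff prefix_snoc)
      then show ?thesis using ad by blast
    qed
  qed
  have pl: "strict_prefix \<sigma> (leftmost_leaf T')" if s: "leaf T' (\<sigma> @ [i])" for \<sigma> i
  proof -
    have "leaf T (\<sigma> @ [i])" "\<sigma> @ [i] \<in> T'" using s lf by auto
    then have "strict_prefix \<sigma> c" "\<not> prefix (b @ [j]) \<sigma>" using par by (auto simp: T'_iff prefix_snoc)
    then have "prefix \<sigma> b" unfolding c2
      by (auto simp: strict_prefix_def prefix_append prefix_Cons)
    then show ?thesis unfolding lc by (auto simp: strict_prefix_def prefix_snoc)
  qed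
  have "height T' \<le> height T"
  proof (rule height_mono[OF fin])
    show "T' \<subseteq> T" by (auto simp: T'_iff)
    show "T' \<noteq> {}" using bs' by blast
  qed
  moreover have "height T \<le> h" using T by (simp add: comb_def)
  ultimately have "height T' \<le> h" by simp
  then show ?thesis unfolding comb_def using fin' rt' ch pl unfolding T'_def by blast
qed

lemma next_compatible: "next_pos h k P \<rho>' (0, b) = Some P' \<Longrightarrow> compatible (rho P) \<rho>'"
proof (induction h k P \<rho>' "(0::nat, b)" arbitrary: P' rule: next_pos.induct)
  case (1 h T \<rho> \<rho>') then show ?case by (auto simp: next_base_def Let_def split: if_splits)
next
  case (2 h k Ps \<rho>') then show ?case by (auto simp: compatible_def)
qed auto

lemma plays_ne: "ps \<in> plays prec h k \<Longrightarrow> ps \<noteq> []" by (induction rule: plays.induct) auto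

lemma plays_prefix: "ps \<in> plays prec h k \<Longrightarrow> ps = qs @ rs \<Longrightarrow> qs \<noteq> [] \<Longrightarrow> qs \<in> plays prec h k"
proof (induction arbitrary: rs rule: plays.induct)
  case (init m) then show ?case using plays.init by (auto simp: append_eq_Cons_conv Cons_eq_append_conv)
next
  case (step ps Q \<rho>' mv P)
  show ?case
  proof (cases rs rule: rev_cases)
    case Nil then show ?thesis using step.prems plays.step[OF step.hyps] by simp
  next
    case (snoc ys y) then show ?thesis using step by auto
  qed
qed

lemma subseq_last: "subseq Ps qs \<Longrightarrow> Ps \<noteq> [] \<Longrightarrow> \<exists>q1 q2. qs = q1 @ q2 \<and> subseq Ps q1 \<and> q1 \<noteq> [] \<and> last q1 = last Ps"
proof (induction qs rule: rev_induct)
  case (snoc q qs)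
  show ?case
  proof (cases "subseq Ps qs")
    case True then show ?thesis using snoc by (metis append.assoc)
  next
    case False
    obtain xs x where Ps: "Ps = xs @ [x]" using snoc(3) by (cases Ps rule: rev_cases) auto
    obtain us vs where uv: "xs @ [x] = us @ vs" "subseq us qs" "subseq vs [q]"
      using snoc(2) unfolding Ps by (metis subseq_append_iff)
    have "vs \<noteq> []" using uv False Ps by auto
    then have "vs = [q]" using uv(3) by (auto elim: list_emb.cases)
    then have "x = q" using uv by simp
    then show ?thesis using snoc Ps by (intro exI[of _ "qs @ [q]"] exI[of _ "[]"]) auto
  qed
qed auto

lemma plays_positions: "ps \<in> plays prec h k \<Longrightarrow> k \<ge> 1 \<Longrightarrow> last ps \<in> positions prec h k"
proof (induction rule: plays.induct)
  case (init m)
  show ?case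
  proof (cases "k = 1")
    case True
    have "leftmost_leaf {[]} = []" by (rule leftmostI) (auto simp: leaf_def)
    then have "comb h {[]}" by (auto simp: comb_def rooted_tree_def leaf_def height_def)
    then show ?thesis using True by auto
  next
    case False
    then obtain j where k: "k = Suc (Suc j)" using init by (metis One_nat_def Suc_le_D le_neq_implies_less less_Suc_eq_le not0_implies_Suc not_less_eq_eq)
    then show ?thesis using plays.init[of "Suc j" m prec h] by (auto intro!: bexI[of _ "[init_pos (Suc j) m]"])
  qed
next
  case (step ps Q \<rho>' mv P)
  obtain c b where mv: "mv = (c, b)" by (cases mv)
  have IH: "last ps \<in> positions prec h k" using step by simp
  consider "k = Suc 0" | j where "k = Suc (Suc j)" using step.prems by (cases k; cases "k - 1") auto
  then show ?case
  proof cases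
    case 1
    then obtain T \<rho> where T: "last ps = Base T \<rho>" "comb h T" "finite (dom \<rho>)" using IH by auto
    have nb: "next_base h T \<rho> \<rho>' (c, b) = Some P" using step.hyps 1 T mv by simp
    have fd: "finite (dom (\<rho> ++ \<rho>'))" using T step.hyps by (auto simp: legal_answer_def)
    let ?g = "leftmost_leaf T"
    show ?thesis
    proof (cases "c = 0")
      case True
      then show ?thesis using nb fd 1 comb_extend[OF T(2)] by (auto simp: next_base_def Let_def split: if_splits)
    next
      case False
      then have a: "c = 1" "strict_prefix b ?g" "b @ [Suc (?g ! length b)] \<in> T" "P = Base (T - {b @ [?g ! length b] @ \<tau> | \<tau>. True}) (\<rho> ++ \<rho>')"
        using nb by (auto simp: next_base_def Let_def split: if_splits)
      obtain j s where j: "?g = b @ j # s" using a(2) by (auto simp: strict_prefix_def prefix_def neq_Nil_conv)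
      then show ?thesis using comb_cut[OF T(2) j] a fd 1 by auto
    qed
  next
    case (2 j)
    then obtain Ps qs where Ps: "last ps = Seq Ps" "Ps \<noteq> []" "qs \<in> plays prec h (Suc j)" "subseq Ps qs" using IH by auto
    from step.hyps Ps 2 mv have np: "next_pos h (Suc (Suc j)) (Seq Ps) \<rho>' (c, b) = Some P" by simp
    show ?thesis
    proof (cases "c \<le> Suc j")
      case True
      then obtain P' where P': "P = Seq (Ps @ [P'])" "next_pos h (Suc j) (last Ps) \<rho>' (c, b) = Some P'" using np by auto
      obtain q1 q2 where q: "qs = q1 @ q2" "subseq Ps q1" "q1 \<noteq> []" "last q1 = last Ps" using subseq_last[OF Ps(4,2)] by blast
      have "q1 @ [P'] \<in> plays prec h (Suc j)"
        apply (rule plays.step[OF plays_prefix[OF Ps(3) q(1,3)], of Q \<rho>' "(c,b)"])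
        using step.hyps Ps q P' True mv by (auto simp: legal_move_def)
      moreover have "subseq (Ps @ [P']) (q1 @ [P'])" using q by (simp add: list_emb_append_mono)
      ultimately show ?thesis using P' 2 by (simp only: positions.simps last_snoc mem_Collect_eq) blast
    next
      case False
      then have b: "hd b < length Ps" using np by (auto split: if_splits)
      then obtain P' where P': "P = Seq (take (hd b) Ps @ [P'])" "next_pos h (Suc j) (Ps ! hd b) \<rho>' (0, [0]) = Some P'" using np False by (auto split: if_splits)
      let ?R = "take (hd b) Ps @ [Ps ! hd b]"
      have "subseq ?R Ps" using b by (metis take_Suc_conv_app_nth prefix_imp_subseq take_is_prefix)
      then have "subseq ?R qs" using Ps(4) by (rule subseq_order.trans)
      from subseq_last[OF this] obtain q1 q2 where q: "qs = q1 @ q2" "subseq ?R q1" "q1 \<noteq> []" "last q1 = Ps ! hd b" by auto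
      have "q1 @ [P'] \<in> plays prec h (Suc j)"
        apply (rule plays.step[OF plays_prefix[OF Ps(3) q(1,3)], of Q \<rho>' "(0,[0])"])
        using step.hyps Ps q P' next_compatible[OF P'(2)] by (auto simp: legal_move_def)
      moreover have "subseq (take (hd b) Ps @ [P']) (q1 @ [P'])" 
        using q(2) by (meson list_emb_append_mono prefixI prefix_imp_subseq subseq_order.order_refl subseq_order.trans)
      ultimately show ?thesis using P' 2
        by (simp only: positions.simps last_snoc mem_Collect_eq) blast
    qed
  qed
qed

lemma run_plays:
  assumes "delayer_strategy prec answ" "prover_strategy k query pick"
  shows "run h k m answ query pick n = Running hs P \<Longrightarrow> \<exists>ps \<in> plays prec h k. last ps = P"
proof (induction n arbitrary: hs P)
  case 0 then show ?case using plays.init[of k m prec h] by (auto intro!: bexI[of _ "[init_pos k m]"])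
next
  case (Suc n)
  then obtain hs0 P0 where r: "run h k m answ query pick n = Running hs0 P0" by (auto split: status.splits)
  let ?Q = "query m hs0" let ?r = "answ hs0 ?Q" let ?mv = "pick m hs0 ?r"
  have nx: "compatible (rho P0) ?r" "next_pos h k P0 ?r ?mv = Some P" using Suc.prems r by (auto simp: Let_def split: if_splits option.splits)
  obtain ps where "ps \<in> plays prec h k" "last ps = P0" using Suc.IH[OF r] by blast
  then have "ps @ [P] \<in> plays prec h k" using plays.step[of ps prec h k ?Q ?r ?mv P] nx assms
    by (auto simp: delayer_strategy_def prover_strategy_def)
  then show ?case by force
qed

lemma run_positions:
  assumes "delayer_strategy prec answ" "prover_strategy k query pick" "k \<ge> 1"
    and "run h k m answ query pick n = Running hs P"
  shows "P \<in> positions prec h k"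
  using run_plays[OF assms(1,2,4)] plays_positions assms(3) by blast

end

theory Submission
  imports Defs
begin

text \<open>
  Every position \<open>P\<close> is assigned an infinite increasing block \<open>\<Psi> P 0, \<Psi> P 1, \<dots>\<close> of numbers in the
  well-order such that every move leads to a position with a lower block. Delayer can then
  answer each query with a fresh number of the current block as witness, so that Prover never wins
  and the play is finite. A comb of height at most \<open>h\<close> has an ordinal rank below \<open>\<omega>^(h + 1)\<close>, and
  each further game costs one exponential: its positions are sequences of positions with falling
  ranks, and the sequence is ranked by the finite set of these ranks.
\<close>

section \<open>Finite-support powers of linear orders\<close>

text \<open>A position of the next game cannot be ranked by one fixed rank per entry: appending an
  entry would enlarge the set of ranks. The last entry must weigh more than it does once it has a
  successor, which suggests ternary digits, whereas the tower has base 2. Hence each position of the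
  old game carries two ranks, \<open>0\<close> and \<open>1\<close>, both above all ranks of its
  successors, and the presence of one or the other plays the part of the digit. The ranks look at
  the trees alone, never at the predicates. The orders carrying them are only asked to be linear;
  well-foundedness is drawn from \<open>prec\<close> at the end.\<close>

lemma finite_has_greatest:
  assumes "Linear_order r" "finite D" "D \<noteq> {}" "D \<subseteq> Field r"
  shows "\<exists>m\<in>D. \<forall>x\<in>D. (x, m) \<in> r"
  using assms(2-4)
proof (induction rule: finite_ne_induct)
  case (singleton x)
  then show ?case using assms(1)
    by (auto simp: linear_order_on_def partial_order_on_def preorder_on_def refl_on_def)
next
  case (insert x F)
  then obtain m where m: "m \<in> F" "\<forall>y\<in>F. (y, m) \<in> r" by auto
  have tr: "trans r" and x: "(x, x) \<in> r" and tot: "(x, m) \<in> r \<or> (m, x) \<in> r"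
    using assms(1) insert.prems insert.hyps m(1)
    by (auto simp: linear_order_on_def partial_order_on_def preorder_on_def refl_on_def total_on_def)
  show ?case
  proof (cases "(x, m) \<in> r")
    case True
    then show ?thesis using m by auto
  next
    case False
    then have "(m, x) \<in> r" using tot by blast
    then have "\<forall>y\<in>F. (y, x) \<in> r" using m tr by (meson transD)
    then show ?thesis using x by auto
  qed
qed

lemma trans_strict: "Linear_order r \<Longrightarrow> trans (r - Id)"
  by (simp add: linear_order_on_def partial_order_on_def preorder_on_def trans_diff_Id)

lemma asym_strict: "Linear_order r \<Longrightarrow> (x, y) \<in> r - Id \<Longrightarrow> (y, x) \<notin> r"
  unfolding linear_order_on_def partial_order_on_def antisym_def by blast

lemma strict_total:
  "Linear_order r \<Longrightarrow> x \<in> Field r \<Longrightarrow> y \<in> Field r \<Longrightarrow> x = y \<or> (x, y) \<in> r - Id \<or> (y, x) \<in> r - Id"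
  unfolding linear_order_on_def total_on_def by blast

lemma Field_oexp: "Field (oexp q r) = fin_supp_funcs q r"
  by (auto simp: Field_def oexp_def)

lemma oexp_strictI:
  assumes "f \<in> fin_supp_funcs q r" "g \<in> fin_supp_funcs q r"
    and "m \<in> Field r" "(f m, g m) \<in> q - Id" "\<And>x. (m, x) \<in> r - Id \<Longrightarrow> f x = g x"
  shows "(f, g) \<in> oexp q r - Id"
  using assms unfolding oexp_def by auto

lemma oexp_strictE:
  assumes "(f, g) \<in> oexp q r - Id"
  obtains m where "f \<in> fin_supp_funcs q r" "g \<in> fin_supp_funcs q r"
    "m \<in> Field r" "(f m, g m) \<in> q - Id" "\<And>x. (m, x) \<in> r - Id \<Longrightarrow> f x = g x"
proof -
  from assms obtain m where m: "f \<in> fin_supp_funcs q r" "g \<in> fin_supp_funcs q r" "m \<in> Field r"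
    "(f m, g m) \<in> q - Id" "\<forall>x\<in>Field r. (m, x) \<in> r \<and> x \<noteq> m \<longrightarrow> f x = g x"
    unfolding oexp_def by auto
  from m(5) have "f x = g x" if "(m, x) \<in> r - Id" for x using that by (auto intro: FieldI2)
  with m that show ?thesis by blast
qed

text \<open>For a composite pair the greatest difference lies at the larger of the two given ones.
  Totality holds because functions of finite support differ at finitely many arguments only, so a
  greatest difference exists.\<close>

lemma Linear_order_oexp:
  assumes q: "Linear_order q" and r: "Linear_order r"
  shows "Linear_order (oexp q r)"
proof -
  let ?S = "oexp q r - Id"
  have tr: "(f, k) \<in> ?S" if fg: "(f, g) \<in> ?S" and gk: "(g, k) \<in> ?S" for f g k
  proof -
    obtain m where m: "f \<in> fin_supp_funcs q r" "g \<in> fin_supp_funcs q r" "m \<in> Field r" "(f m, g m) \<in> q - Id"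
      "\<And>x. (m, x) \<in> r - Id \<Longrightarrow> f x = g x" using oexp_strictE[OF fg] by metis
    obtain n where n: "g \<in> fin_supp_funcs q r" "k \<in> fin_supp_funcs q r" "n \<in> Field r" "(g n, k n) \<in> q - Id"
      "\<And>x. (n, x) \<in> r - Id \<Longrightarrow> g x = k x" using oexp_strictE[OF gk] by metis
    consider "m = n" | "(m, n) \<in> r - Id" | "(n, m) \<in> r - Id"
      using strict_total[OF r m(3) n(3)] by blast
    then show ?thesis
    proof cases
      case 1
      then have "(f m, k m) \<in> q - Id" using transD[OF trans_strict[OF q]] m(4) n(4) by blast
      then show ?thesis using 1 m n by (intro oexp_strictI[of f q r k m]) auto
    next
      case 2
      then have "f x = k x" if "(n, x) \<in> r - Id" for x
        using transD[OF trans_strict[OF r] 2 that] m(5) n(5)[OF that] by simp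
      then show ?thesis using 2 m(1,5) n by (intro oexp_strictI[of f q r k n]) auto
    next
      case 3
      then have "f x = k x" if "(m, x) \<in> r - Id" for x
        using transD[OF trans_strict[OF r] 3 that] n(5) m(5)[OF that] by simp
      then show ?thesis using 3 m n(2,5) by (intro oexp_strictI[of f q r k m]) auto
    qed
  qed
  have "trans (oexp q r)" using tr unfolding trans_def by blast
  \<comment> \<open>By \<open>tr\<close>, two opposite strict pairs would give a strict pair
    \<open>(f, f)\<close>.\<close>
  moreover have "antisym (oexp q r)" using tr unfolding antisym_def by blast
  moreover have "refl_on (fin_supp_funcs q r) (oexp q r)" by (auto simp: refl_on_def oexp_def)
  moreover have "oexp q r \<subseteq> fin_supp_funcs q r \<times> fin_supp_funcs q r" by (auto simp: oexp_def)
  moreover have "total_on (fin_supp_funcs q r) (oexp q r)" unfolding total_on_def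
  proof (intro ballI impI)
    fix f g assume f: "f \<in> fin_supp_funcs q r" and g: "g \<in> fin_supp_funcs q r" and ne: "f \<noteq> g"
    let ?D = "{x \<in> Field r. f x \<noteq> g x}" and ?z = "wo_rel.minim q (Field q)"
    have "finite ({x \<in> Field r. f x \<noteq> ?z} \<union> {x \<in> Field r. g x \<noteq> ?z})"
      using f g by (simp add: fin_supp_funcs_def)
    then have "finite ?D" by (rule rev_finite_subset) auto
    moreover have "?D \<noteq> {}" using f g ne by (auto simp: fin_supp_funcs_def Func_def fun_eq_iff) metis
    ultimately obtain m where m: "m \<in> ?D" "\<forall>x\<in>?D. (x, m) \<in> r"
      using finite_has_greatest[OF r, of ?D] by blast
    have eq: "f x = g x" if "(m, x) \<in> r - Id" for x
      using asym_strict[OF r that] m that by (auto intro: FieldI2)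
    have "f m \<in> Field q" "g m \<in> Field q" using f g m(1) by (auto simp: fin_supp_funcs_def Func_def)
    then have "(f m, g m) \<in> q - Id \<or> (g m, f m) \<in> q - Id" using strict_total[OF q] m(1) by blast
    then show "(f, g) \<in> oexp q r \<or> (g, f) \<in> oexp q r"
      using oexp_strictI[OF f g, of m] oexp_strictI[OF g f, of m] m(1) eq by auto
  qed
  ultimately show ?thesis
    by (simp add: linear_order_on_def partial_order_on_def preorder_on_def Field_oexp)
qed

text \<open>Such a function is determined by its graph off the default value, a finite subset of a
  countable set. Countability is what makes the choice in \<open>on_nat\<close> an
  injection.\<close>

lemma countable_fin_supp_funcs:
  assumes "countable (Field q)" "countable (Field r)"
  shows "countable (fin_supp_funcs q r)"
proof -
  let ?z = "wo_rel.minim q (Field q)"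
  define G where "G = (\<lambda>f. {(x, f x) | x. x \<in> Field r \<and> f x \<noteq> ?z})"
  have G: "(x, y) \<in> G f \<longleftrightarrow> x \<in> Field r \<and> y = f x \<and> f x \<noteq> ?z" for f x y by (auto simp: G_def)
  have "inj_on G (fin_supp_funcs q r)"
  proof (rule inj_onI)
    fix f g assume fg: "f \<in> fin_supp_funcs q r" "g \<in> fin_supp_funcs q r" "G f = G g"
    have "f x = g x" for x
    proof (cases "x \<in> Field r")
      case True
      then show ?thesis using G[of x "f x" f] G[of x "f x" g] G[of x "g x" g] G[of x "g x" f]
        unfolding fg(3) by metis
    qed (use fg in \<open>auto simp: fin_supp_funcs_def Func_def\<close>)
    then show "f = g" by blast
  qed
  moreover have "G ` fin_supp_funcs q r \<subseteq> {A. finite A \<and> A \<subseteq> Field r \<times> Field q}"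
  proof clarify
    fix f assume f: "f \<in> fin_supp_funcs q r"
    then have "finite ((\<lambda>x. (x, f x)) ` {x \<in> Field r. f x \<noteq> ?z})" by (simp add: fin_supp_funcs_def)
    moreover have "G f = (\<lambda>x. (x, f x)) ` {x \<in> Field r. f x \<noteq> ?z}" by (auto simp: G_def)
    ultimately show "finite (G f) \<and> G f \<subseteq> Field r \<times> Field q"
      using f by (auto simp: fin_supp_funcs_def Func_def G_def)
  qed
  moreover have "countable {A. finite A \<and> A \<subseteq> Field r \<times> Field q}"
    using assms by (intro countable_Collect_finite_subset) auto
  ultimately show ?thesis by (intro countable_image_inj_on[of G]) (auto intro: countable_subset)
qed

section \<open>Rankings of positions\<close>

text \<open>The ranks \<open>lo\<close> below all others turn two ranks per position (\<open>N = {0, 1}\<close>) into infinitely many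
  in the next game.\<close>

definition ranking :: "nat rel \<Rightarrow> nat \<Rightarrow> nat \<Rightarrow> nat set \<Rightarrow> 'a rel \<Rightarrow>
    (position \<Rightarrow> nat \<Rightarrow> 'a) \<Rightarrow> (nat \<Rightarrow> 'a) \<Rightarrow> bool" where
  "ranking prec h k N r \<Phi> lo \<longleftrightarrow> Linear_order r \<and>
     (\<forall>i j. i < j \<longrightarrow> (lo i, lo j) \<in> r - Id) \<and>
     (\<forall>P\<in>positions prec h k. \<forall>n\<in>N. (\<forall>i. (lo i, \<Phi> P n) \<in> r - Id) \<and>
        (\<forall>n'\<in>N. (n < n' \<longrightarrow> (\<Phi> P n, \<Phi> P n') \<in> r - Id) \<and>
           (\<forall>\<rho>' mv P'. next_pos h k P \<rho>' mv = Some P' \<longrightarrow> (\<Phi> P' n', \<Phi> P n) \<in> r - Id)))"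

lemma on_nat_strict_embed:
  assumes "Linear_order r" "countable (Field r)"
  obtains f where "Linear_order (on_nat r)" "\<And>x y. (x, y) \<in> r - Id \<Longrightarrow> (f x, f y) \<in> on_nat r - Id"
proof -
  define f where "f = (SOME f :: 'a \<Rightarrow> nat. inj_on f (Field r))"
  have "\<exists>f :: 'a \<Rightarrow> nat. inj_on f (Field r)" using assms(2) by (auto simp: countable_def)
  then have inj: "inj_on f (Field r)" unfolding f_def by (rule someI_ex)
  have "Linear_order (on_nat r)"
    unfolding on_nat_def f_def[symmetric] by (rule Linear_order_dir_image[OF assms(1) inj])
  moreover have "(f x, f y) \<in> on_nat r - Id" if "(x, y) \<in> r - Id" for x y
    using that inj unfolding on_nat_def f_def[symmetric] dir_image_def
    by (auto simp: inj_on_def intro: FieldI1 FieldI2)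
  ultimately show thesis using that by blast
qed

text \<open>Apart from linearity, a ranking consists of strict inequalities, so a strictly
  increasing map into a linear order carries it along.\<close>

lemma ranking_on_nat:
  assumes "ranking prec h k N r \<Phi> lo" "countable (Field r)"
  shows "\<exists>\<Phi>' lo'. ranking prec h k N (on_nat r) \<Phi>' lo'"
proof -
  have lin: "Linear_order r" using assms(1) by (simp add: ranking_def)
  obtain f where f: "Linear_order (on_nat r)" "\<And>x y. (x, y) \<in> r - Id \<Longrightarrow> (f x, f y) \<in> on_nat r - Id"
    using on_nat_strict_embed[OF lin assms(2)] by blast
  have "ranking prec h k N (on_nat r) (\<lambda>P n. f (\<Phi> P n)) (\<lambda>i. f (lo i))"
    unfolding ranking_def
    using f(1) assms(1)[unfolded ranking_def] by (intro conjI allI ballI impI f(2)) blast+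
  then show ?thesis by blast
qed

lemma ranking_subset: "ranking prec h k N r \<Phi> lo \<Longrightarrow> M \<subseteq> N \<Longrightarrow> ranking prec h k M r \<Phi> lo"
  unfolding ranking_def by (meson subsetD)

lemma minim_natLeq_on: "n > 0 \<Longrightarrow> wo_rel.minim (natLeq_on n) {x. x < n} = 0"
  by (rule wo_rel.equals_minim[OF natLeq_on_wo_rel, symmetric]) (auto simp: Field_natLeq_on)

lemma Linear_order_natLeq_on: "Linear_order (natLeq_on n)"
  using natLeq_on_Well_order[of n] by (simp add: well_order_on_def)

text \<open>An entry is a term of some play, hence the last term of an initial part of it, and
  nonempty initial parts of plays are plays.\<close>

lemma positions_SucE:
  assumes "P \<in> positions prec h (Suc k)" "k \<ge> 1"
  obtains Ps ps where "P = Seq Ps" "Ps \<noteq> []" "subseq Ps ps" "ps \<in> plays prec h k"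
    "\<And>P. P \<in> set Ps \<Longrightarrow> P \<in> positions prec h k"
proof -
  obtain Ps ps where P: "P = Seq Ps" "Ps \<noteq> []" "subseq Ps ps" "ps \<in> plays prec h k"
    using assms by (cases k) auto
  have "R \<in> positions prec h k" if "R \<in> set Ps" for R
  proof -
    have "subseq [R] Ps" using that by (simp add: subseq_singleton_left)
    then have "subseq [R] ps" using P(3) by (rule subseq_order.trans)
    then have "R \<in> set ps" by (simp add: subseq_singleton_left)
    then obtain qs rs where "ps = (qs @ [R]) @ rs" by (metis append_Cons append_Nil append_assoc split_list)
    then have "qs @ [R] \<in> plays prec h k" using plays_prefix[OF P(4)] by blast
    from plays_positions[OF this assms(2)] show ?thesis by simp
  qed
  then show ?thesis using P that by blast
qed

lemma next_pos_Suc: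
  assumes "k \<ge> 1" "next_pos h (Suc k) (Seq Ps) \<rho>' mv = Some P'"
  obtains (extend) R where "P' = Seq (Ps @ [R])" "next_pos h k (last Ps) \<rho>' mv = Some R"
  | (backtrack) b R where "b < length Ps" "P' = Seq (take b Ps @ [R])"
      "next_pos h k (Ps ! b) \<rho>' (0, [0]) = Some R"
proof -
  obtain j c b where k: "k = Suc j" and mv: "mv = (c, b)" using assms(1) by (cases k; cases mv) auto
  show thesis
  proof (cases "c \<le> k")
    case True
    then show thesis using assms(2) extend unfolding k mv by (auto simp del: next_pos.simps(1))
  next
    case False
    then show thesis using assms(2) backtrack[of "hd b"] unfolding k mv by (auto split: if_splits)
  qed
qed

section \<open>Ranks of combs\<close>

lemma height_ge: "finite T \<Longrightarrow> x \<in> T \<Longrightarrow> length x \<le> height T"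
  by (simp add: height_def)

text \<open>Every node of a finite tree lies below some leaf, and a leaf above a smaller sibling
  would precede the leftmost one.\<close>

lemma leftmost_leaf_least:
  assumes T: "finite T" "rooted_tree T" and i: "i < length (leftmost_leaf T)"
    and j: "take i (leftmost_leaf T) @ [j] \<in> T"
  shows "leftmost_leaf T ! i \<le> j"
proof (rule ccontr)
  let ?c = "leftmost_leaf T"
  assume less: "\<not> ?c ! i \<le> j"
  obtain x where x: "leaf T x" "prefix (take i ?c @ [j]) x" using leaf_above[OF T(1) j] by blast
  then obtain w where "x = take i ?c @ j # w" by (auto simp: prefix_def)
  moreover have "?c = take i ?c @ ?c ! i # drop (Suc i) ?c" using i by (rule id_take_nth_drop)
  ultimately have "x < ?c" using split_less less by (metis not_le)
  then show False using leftmost(2)[OF T x(1)] by simp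
qed

text \<open>A leaf lexicographically below \<open>c\<close> would leave the path to \<open>c\<close>
  at a smaller child. This local criterion makes the leftmost leaf easy to follow through a
  move.\<close>

lemma leftmost_leaf_eqI:
  assumes T: "finite T" "rooted_tree T" and c: "leaf T c"
    and least: "\<And>i j. i < length c \<Longrightarrow> take i c @ [j] \<in> T \<Longrightarrow> c ! i \<le> j"
  shows "leftmost_leaf T = c"
proof (rule leftmostI[OF T(1) c])
  fix x assume x: "leaf T x"
  show "c \<le> x"
  proof (rule ccontr)
    assume "\<not> c \<le> x"
    then have "x < c" by simp
    moreover have "\<not> prefix x c" using leaf_prefix[OF T(2) x, of c] c \<open>x < c\<close> by (auto simp: leaf_def)
    ultimately obtain u a b v w where u: "a < b" "x = u @ a # v" "c = u @ b # w"
      using less_split by blast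
    have "u @ [a] \<in> T" using x u(2) T(2) unfolding leaf_def rooted_tree_def
      by (metis append_Cons append_Nil append_assoc prefixI)
    then show False using least[of "length u" a] u by simp
  qed
qed

lemma leftmost_leaf_extend:
  assumes T: "comb h T" and h: "height (T \<union> {leftmost_leaf T @ [i] | i. i \<le> b}) \<le> h"
  shows "leftmost_leaf (T \<union> {leftmost_leaf T @ [i] | i. i \<le> (b::nat)}) = leftmost_leaf T @ [0]"
proof -
  let ?c = "leftmost_leaf T" and ?T = "T \<union> {leftmost_leaf T @ [i] | i. i \<le> b}"
  have fin: "finite T" "rooted_tree T" using T by (auto simp: comb_def)
  have fin': "finite ?T" "rooted_tree ?T" using comb_extend[OF T h] by (auto simp: comb_def)
  have c: "leaf T ?c" using leftmost(1)[OF fin] .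
  have "?c @ [0, i] \<notin> T" for i
    using c fin(2) unfolding leaf_def rooted_tree_def
    by (metis append_Cons append_Nil append_assoc prefixI)
  then have "leaf ?T (?c @ [0])" by (auto simp: leaf_def)
  then show ?thesis
  proof (rule leftmost_leaf_eqI[OF fin'])
    fix i j assume "i < length (?c @ [0])" "take i (?c @ [0]) @ [j] \<in> ?T"
    then show "(?c @ [0]) ! i \<le> j"
      using leftmost_leaf_least[OF fin, of i j] by (cases "i = length ?c") (auto simp: nth_append)
  qed
qed

text \<open>The comb condition makes the right sibling itself a leaf: the parent of a deeper leaf
  above it would lie on the old leftmost path, which runs through \<open>b @ [j]\<close>
  instead.\<close>

lemma leftmost_leaf_cut:
  assumes T: "comb h T" and c: "leftmost_leaf T = b @ j # s" and bs: "b @ [Suc j] \<in> T"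
  shows "leftmost_leaf (T - {b @ [j] @ \<tau> | \<tau>. True}) = b @ [Suc j]"
proof -
  let ?T = "T - {b @ [j] @ \<tau> | \<tau>. True}"
  have fin: "finite T" "rooted_tree T" using T by (auto simp: comb_def)
  have fin': "finite ?T" "rooted_tree ?T" using comb_cut[OF T c bs] by (auto simp: comb_def)
  have "b @ [Suc j, i] \<notin> T" for i
  proof
    assume "b @ [Suc j, i] \<in> T"
    then obtain l where l: "leaf T l" "prefix (b @ [Suc j, i]) l" using leaf_above[OF fin(1)] by blast
    then obtain w where w: "l = (b @ [Suc j]) @ i # w" by (auto simp: prefix_def)
    define l' where "l' = butlast l"
    have "l \<noteq> []" using w by simp
    then have "l = l' @ [last l]" by (simp add: l'_def)
    then have "strict_prefix l' (leftmost_leaf T)" using l(1) T unfolding comb_def by metis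
    moreover have "prefix (b @ [Suc j]) l'" unfolding l'_def w by (simp add: butlast_append)
    ultimately have "prefix (b @ [Suc j]) (b @ j # s)"
      using c by (metis prefix_order.trans strict_prefix_def)
    then show False by simp
  qed
  then have "leaf ?T (b @ [Suc j])" using bs by (auto simp: leaf_def)
  then show ?thesis
  proof (rule leftmost_leaf_eqI[OF fin'])
    fix i x assume i: "i < length (b @ [Suc j])" and x: "take i (b @ [Suc j]) @ [x] \<in> ?T"
    then have "leftmost_leaf T ! i \<le> x" using leftmost_leaf_least[OF fin, of i x] by (auto simp: c)
    then show "(b @ [Suc j]) ! i \<le> x"
      using i x by (cases "i = length b") (auto simp: c nth_append less_Suc_eq Suc_le_eq le_less)
  qed
qed

text \<open>With \<open>s\<^sub>i\<close> the number of right siblings of the \<open>i\<close>-th node on the way to the leftmost leaf, at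
  depth \<open>l\<close>, a comb gets the rank with coefficient \<open>3 s\<^sub>i\<close> at \<open>\<omega>^(h - i)\<close> for \<open>i < l\<close> and
  \<open>3 s\<^sub>l + 1 + e\<close> at \<open>\<omega>^(h - l)\<close>, where \<open>e \<in> {0, 1}\<close> leaves room for two ranks per position. The
  convention \<open>s\<^sub>0 = 1\<close> keeps all these ranks above the finite ordinals, since \<open>h > 0\<close>.\<close>

definition siblings :: "nat list set \<Rightarrow> nat \<Rightarrow> nat" where
  "siblings T i = (case i of 0 \<Rightarrow> 1
     | Suc i \<Rightarrow> card {x. take i (leftmost_leaf T) @ [x] \<in> T \<and> leftmost_leaf T ! i < x})"

definition digit :: "nat list set \<Rightarrow> nat \<Rightarrow> nat \<Rightarrow> nat" where
  "digit T e i = (let l = length (leftmost_leaf T) in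
     if i < l then 3 * siblings T i else if i = l then 3 * siblings T i + 1 + e else 0)"

text \<open>The index is reversed because \<open>oexp\<close> compares at the largest argument,
  while the shallowest depth has to dominate. The value \<open>undefined\<close> beyond
  \<open>h\<close> is the one that \<open>Func\<close> prescribes.\<close>

definition numeral_of :: "nat \<Rightarrow> (nat \<Rightarrow> nat) \<Rightarrow> nat \<Rightarrow> nat" where
  "numeral_of h d = (\<lambda>j. if j \<le> h then d (h - j) else undefined)"

lemma numeral_of_less:
  assumes "i \<le> h" "d i < d' i" "\<And>i'. i' < i \<Longrightarrow> d i' = d' i'"
  shows "(numeral_of h d, numeral_of h d') \<in> oexp natLeq (natLeq_on (h + 1)) - Id"
proof -
  have supp: "numeral_of h d \<in> fin_supp_funcs natLeq (natLeq_on (h + 1))" for d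
    by (auto simp: fin_supp_funcs_def Func_def Field_natLeq_on Field_natLeq numeral_of_def)
  show ?thesis
    by (rule oexp_strictI[OF supp supp, of "h - i"])
      (use assms in \<open>auto simp: Field_natLeq_on numeral_of_def natLeq_def\<close>)
qed

lemma digit_extend:
  assumes T: "comb h T" and h: "height (T \<union> {leftmost_leaf T @ [i] | i. i \<le> b}) \<le> h"
    and T': "T' = T \<union> {leftmost_leaf T @ [i] | i. i \<le> (b::nat)}"
  shows "(numeral_of h (digit T' e'), numeral_of h (digit T e)) \<in> oexp natLeq (natLeq_on (h + 1)) - Id"
proof (rule numeral_of_less)
  let ?c = "leftmost_leaf T"
  have c': "leftmost_leaf T' = ?c @ [0]" using leftmost_leaf_extend[OF T h] by (simp add: T')
  have fin: "finite T" "rooted_tree T" using T by (auto simp: comb_def)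
  have "?c \<in> T" using leftmost(1)[OF fin] by (simp add: leaf_def)
  then show "length ?c \<le> h" using height_ge[OF fin(1)] T unfolding comb_def by fastforce
  have sib: "siblings T' i = siblings T i" if "i \<le> length ?c" for i
  proof (cases i)
    case (Suc n)
    have "take n ?c @ [x] \<in> T' \<longleftrightarrow> take n ?c @ [x] \<in> T" for x
      using that Suc by (auto simp: T' dest: arg_cong[of _ _ length])
    then show ?thesis using that Suc by (simp add: siblings_def c' nth_append)
  qed (simp add: siblings_def)
  \<comment> \<open>The old leaf is now an inner node of the path, so its digit loses the summand
    \<open>1 + e\<close>.\<close>
  show "digit T' e' (length ?c) < digit T e (length ?c)" by (simp add: digit_def c' sib)
  show "digit T' e' i = digit T e i" if "i < length ?c" for i using that by (simp add: digit_def c' sib)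
qed

lemma digit_cut:
  assumes T: "comb h T" and c: "leftmost_leaf T = b @ j # s" and bs: "b @ [Suc j] \<in> T"
    and T': "T' = T - {b @ [j] @ \<tau> | \<tau>. True}" and e': "e' \<le> 1"
  shows "(numeral_of h (digit T' e'), numeral_of h (digit T e)) \<in> oexp natLeq (natLeq_on (h + 1)) - Id"
proof (rule numeral_of_less)
  let ?l = "Suc (length b)"
  have c': "leftmost_leaf T' = b @ [Suc j]" using leftmost_leaf_cut[OF T c bs] by (simp add: T')
  have fin: "finite T" "rooted_tree T" using T by (auto simp: comb_def)
  show "?l \<le> h" using height_ge[OF fin(1) bs] T unfolding comb_def by simp
  have sib: "siblings T' i = siblings T i" if "i < ?l" for i
  proof (cases i)
    case (Suc n)
    have "take n b @ [x] \<in> T' \<longleftrightarrow> take n b @ [x] \<in> T" for x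
      using that Suc by (auto simp: T' dest: arg_cong[of _ _ length])
    then show ?thesis using that Suc by (simp add: siblings_def c c' nth_append)
  qed (simp add: siblings_def)
  have "inj (\<lambda>x. b @ [x])" by (simp add: inj_def)
  then have "finite {x. b @ [x] \<in> T}" using finite_vimageI[OF fin(1), of "\<lambda>x. b @ [x]"] by (simp add: vimage_def)
  moreover have "{x. b @ [x] \<in> T \<and> j < x} = insert (Suc j) {x. b @ [x] \<in> T' \<and> Suc j < x}"
    using bs by (auto simp: T')
  moreover have "finite {x. b @ [x] \<in> T' \<and> Suc j < x}"
    using calculation(1) by (rule rev_finite_subset) (auto simp: T')
  ultimately have "siblings T ?l = Suc (siblings T' ?l)" by (simp add: siblings_def c c')
  \<comment> \<open>With \<open>s\<close> old siblings the new digit is at most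
    \<open>3 * (s - 1) + 2\<close>, the old one at least \<open>3 * s\<close>; this is where the
    factor 3 comes from.\<close>
  then show "digit T' e' ?l < digit T e ?l" using e' by (simp add: digit_def c c')
  show "digit T' e' i = digit T e i" if "i < ?l" for i using that by (simp add: digit_def c c' sib)
qed

lemma ranking_base:
  assumes h: "h > 0"
  shows "ranking prec h 1 {0, 1} (oexp natLeq (natLeq_on (h + 1)))
    (\<lambda>P e. case P of Base T _ \<Rightarrow> numeral_of h (digit T e) | _ \<Rightarrow> undefined)
    (\<lambda>n. numeral_of h (\<lambda>i. if i = h then n else 0))"
proof -
  have lo: "(numeral_of h (\<lambda>i. if i = h then m else 0), numeral_of h (\<lambda>i. if i = h then n else 0))
      \<in> oexp natLeq (natLeq_on (h + 1)) - Id" if "m < n" for m n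
    by (rule numeral_of_less[of h]) (use that in auto)
  \<comment> \<open>Depth 0 decides: a comb has digit at least 3 there, and the finite ordinal
    \<open>lo n\<close> has 0.\<close>
  have lo_lt: "(numeral_of h (\<lambda>i. if i = h then n else 0), numeral_of h (digit T e))
      \<in> oexp natLeq (natLeq_on (h + 1)) - Id" for n T e
    by (rule numeral_of_less[of 0]) (use h in \<open>auto simp: digit_def siblings_def Let_def\<close>)
  have bit: "(numeral_of h (digit T d), numeral_of h (digit T e)) \<in> oexp natLeq (natLeq_on (h + 1)) - Id"
    if T: "comb h T" and "d < e" for T d e
  proof (rule numeral_of_less)
    have fin: "finite T" "rooted_tree T" using T by (auto simp: comb_def)
    have "leftmost_leaf T \<in> T" using leftmost(1)[OF fin] by (simp add: leaf_def)
    then show "length (leftmost_leaf T) \<le> h" using height_ge[OF fin(1)] T unfolding comb_def by fastforce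
  qed (use that in \<open>auto simp: digit_def\<close>)
  have nxt: "(case P' of Base T' _ \<Rightarrow> numeral_of h (digit T' e') | _ \<Rightarrow> undefined, numeral_of h (digit T e))
      \<in> oexp natLeq (natLeq_on (h + 1)) - Id"
    if T: "comb h T" and e': "e' \<le> 1" and P': "next_base h T \<rho> \<rho>' mv = Some P'" for T \<rho> \<rho>' mv P' e e'
  proof -
    obtain a b where mv: "mv = (a, b)" by (cases mv)
    let ?c = "leftmost_leaf T"
    consider T' \<sigma> where "P' = Base T' \<sigma>" "T' = T \<union> {?c @ [i] | i. i \<le> hd b}" "height T' \<le> h"
      | T' \<sigma> where "P' = Base T' \<sigma>" "strict_prefix b ?c" "b @ [Suc (?c ! length b)] \<in> T"
        "T' = T - {b @ [?c ! length b] @ \<tau> | \<tau>. True}"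
      using P' by (auto simp: next_base_def mv Let_def split: if_splits)
    then show ?thesis
    proof cases
      case 1
      then show ?thesis using digit_extend[OF T _ 1(2)] by simp
    next
      case 2
      then obtain j s where "?c = b @ j # s" by (auto simp: strict_prefix_def prefix_def neq_Nil_conv)
      then show ?thesis using digit_cut[OF T _ _ _ e'] 2 by simp
    qed
  qed
  have pos: "\<exists>T \<rho>. P = Base T \<rho> \<and> comb h T" if "P \<in> positions prec h 1" for P using that by auto
  show ?thesis unfolding ranking_def
  proof (intro conjI allI ballI impI)
    fix P and e e' :: nat assume P: "P \<in> positions prec h 1" and e: "e \<in> {0, 1}" "e' \<in> {0, 1}"
    obtain T \<rho> where T: "P = Base T \<rho>" "comb h T" using pos[OF P] by blast
    fix \<rho>' mv P' assume "next_pos h 1 P \<rho>' mv = Some P'"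
    then have "next_base h T \<rho> \<rho>' mv = Some P'" by (simp add: T)
    moreover have "e' \<le> 1" using e(2) by auto
    ultimately show "(case P' of Base T _ \<Rightarrow> numeral_of h (digit T e') | _ \<Rightarrow> undefined,
        case P of Base T _ \<Rightarrow> numeral_of h (digit T e) | _ \<Rightarrow> undefined)
      \<in> oexp natLeq (natLeq_on (h + 1)) - Id" unfolding T(1) position.case by (intro nxt[OF T(2)])
  next
    fix P and e e' :: nat assume P: "P \<in> positions prec h 1" and less: "e < e'"
    obtain T \<rho> where T: "P = Base T \<rho>" "comb h T" using pos[OF P] by blast
    show "(case P of Base T _ \<Rightarrow> numeral_of h (digit T e) | _ \<Rightarrow> undefined,
        case P of Base T _ \<Rightarrow> numeral_of h (digit T e') | _ \<Rightarrow> undefined)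
      \<in> oexp natLeq (natLeq_on (h + 1)) - Id" unfolding T(1) position.case using T(2) less by (rule bit)
  next
    fix P n and e :: nat assume P: "P \<in> positions prec h 1"
    obtain T \<rho> where T: "P = Base T \<rho>" "comb h T" using pos[OF P] by blast
    show "(numeral_of h (\<lambda>i. if i = h then n else 0),
        case P of Base T _ \<Rightarrow> numeral_of h (digit T e) | _ \<Rightarrow> undefined)
      \<in> oexp natLeq (natLeq_on (h + 1)) - Id" unfolding T(1) position.case by (rule lo_lt)
  qed (use lo in \<open>simp_all add: Linear_order_oexp natLeq_Linear_order Linear_order_natLeq_on\<close>)
qed

section \<open>Ranks in the higher games\<close>

text \<open>The tower has base 2, so finite sets of old ranks, compared at the greatest rank where they
  differ, are the elements of the next level.\<close>

definition indic :: "'a rel \<Rightarrow> 'a set \<Rightarrow> 'a \<Rightarrow> nat" where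
  "indic r S = (\<lambda>x. if x \<in> Field r then if x \<in> S then 1 else 0 else undefined)"

lemma indic_fin_supp: "finite S \<Longrightarrow> indic r S \<in> fin_supp_funcs (natLeq_on 2) r"
  by (auto simp: fin_supp_funcs_def indic_def minim_natLeq_on[of 2] Func_def Field_natLeq_on elim: rev_finite_subset)

text \<open>A power of 2 exceeds every finite sum of distinct smaller powers. The shared part
  \<open>H\<close> may have elements on both sides of \<open>m\<close>; beyond \<open>m\<close> the
  two sets agree.\<close>

lemma indic_less:
  assumes "Linear_order r" "finite H" "finite L" "finite L'" "m \<in> Field r" "m \<notin> H"
    and "\<And>x. x \<in> L \<union> L' \<Longrightarrow> (x, m) \<in> r - Id"
  shows "(indic r (H \<union> L'), indic r (insert m (H \<union> L))) \<in> oexp (natLeq_on 2) r - Id"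
proof (rule oexp_strictI)
  have "m \<notin> L'" using assms(7) by blast
  then show "(indic r (H \<union> L') m, indic r (insert m (H \<union> L)) m) \<in> natLeq_on 2 - Id"
    using assms(5,6) by (simp add: indic_def)
  fix x assume x: "(m, x) \<in> r - Id"
  then have "x \<notin> L" "x \<notin> L'" "x \<noteq> m" using assms(7)[of x] asym_strict[OF assms(1) x] by auto
  then show "indic r (H \<union> L') x = indic r (insert m (H \<union> L)) x" by (simp add: indic_def)
qed (use assms in \<open>auto intro!: indic_fin_supp\<close>)

text \<open>Each position spans the interval from its rank \<open>0\<close> to its rank
  \<open>1\<close>, and along a play these intervals descend without overlap. Relating all pairs of
  terms, not only neighbours, lets the property pass to subsequences.\<close>

lemma ranking_plays_sorted:
  assumes R: "ranking prec h k {0, 1} r \<Phi> lo" and k: "k \<ge> 1"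
  shows "ps \<in> plays prec h k \<Longrightarrow> sorted_wrt (\<lambda>P P'. (\<Phi> P' 1, \<Phi> P 0) \<in> r - Id) ps"
proof (induction rule: plays.induct)
  case (step ps Q \<rho>' mv P)
  have tr: "trans (r - Id)" using R by (simp add: ranking_def trans_strict)
  have pos: "last ps \<in> positions prec h k" using plays_positions[OF step.hyps(1) k] .
  have new: "(\<Phi> P 1, \<Phi> (last ps) 0) \<in> r - Id"
    using R pos step.hyps(6) unfolding ranking_def by blast
  have old: "(\<Phi> (last ps) 0, \<Phi> (last ps) 1) \<in> r - Id"
    using R pos zero_less_one[where 'a=nat] unfolding ranking_def by blast
  obtain qs where qs: "ps = qs @ [last ps]" using plays_ne[OF step.hyps(1)] by (metis append_butlast_last_id)
  have "(\<Phi> P 1, \<Phi> P' 0) \<in> r - Id" if "P' \<in> set ps" for P'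
  proof -
    have "P' = last ps \<or> P' \<in> set qs" using that by (subst (asm) qs) auto
    moreover have "(\<Phi> (last ps) 1, \<Phi> P' 0) \<in> r - Id" if "P' \<in> set qs"
      using step.IH that by (subst (asm) qs) (simp add: sorted_wrt_append)
    ultimately show ?thesis using new old transD[OF tr] by metis
  qed
  then show ?case using step.IH by (simp add: sorted_wrt_append)
qed simp

definition last_set :: "(position \<Rightarrow> nat \<Rightarrow> 'a) \<Rightarrow> position \<Rightarrow> 'a set" where
  "last_set \<Phi> P = (case P of Seq Ps \<Rightarrow> (\<lambda>P. \<Phi> P 0) ` set (butlast Ps) \<union> {\<Phi> (last Ps) 1} | _ \<Rightarrow> {})"

lemma last_set_snoc: "last_set \<Phi> (Seq (Ps @ [P])) = (\<lambda>P. \<Phi> P 0) ` set Ps \<union> {\<Phi> P 1}"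
  by (simp add: last_set_def)

lemma sorted_wrt_subseq: "subseq xs ys \<Longrightarrow> sorted_wrt R ys \<Longrightarrow> sorted_wrt R xs"
  by (induction rule: list_emb.induct) (auto dest: list_emb_set)

text \<open>A position \<open>P\<^sub>0, \<dots>, P\<^sub>l\<close> gets the ranks \<open>\<Phi> P\<^sub>i 0\<close> for \<open>i < l\<close> and
  \<open>\<Phi> P\<^sub>l 1\<close>, as in \<open>3^\<alpha>\<^sub>0 + \<dots> + 3^\<alpha>\<^bsub>l-1\<^esub> + 3^\<alpha>\<^sub>l * 2\<close>. Appending replaces \<open>\<Phi> P\<^sub>l 1\<close> by
  \<open>\<Phi> P\<^sub>l 0\<close> and lower ranks; backtracking to \<open>P\<^sub>b\<close> replaces the rank of \<open>P\<^sub>b\<close> by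
  lower ones.\<close>

lemma ranking_Suc:
  assumes R: "ranking prec h k {0, 1} r \<Phi> lo" and k: "k \<ge> 1"
  shows "ranking prec h (Suc k) UNIV (oexp (natLeq_on 2) r)
    (\<lambda>P n. indic r (last_set \<Phi> P \<union> {lo n})) (\<lambda>n. indic r {lo n})"
proof -
  define lt where "lt x y \<longleftrightarrow> (x, y) \<in> r - Id" for x y
  note lin = R[unfolded ranking_def, THEN conjunct1]
  have lt_trans: "lt x z" if "lt x y" "lt y z" for x y z
    using transD[OF trans_strict[OF lin]] that unfolding lt_def by blast
  have lt_irrefl: "\<not> lt x x" for x by (simp add: lt_def)
  have lt_field: "x \<in> Field r" "y \<in> Field r" if "lt x y" for x y
    using that by (auto simp: lt_def intro: FieldI1 FieldI2)
  have lo: "lt (lo i) (lo j)" if "i < j" for i j using R that by (simp add: ranking_def lt_def)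
  have lo_lt: "lt (lo i) (\<Phi> P 0)" "lt (lo i) (\<Phi> P 1)" "lt (\<Phi> P 0) (\<Phi> P 1)"
    if "P \<in> positions prec h k" for P i
    using R that unfolding ranking_def lt_def by auto
  have nx: "lt (\<Phi> P' 1) (\<Phi> P 0)"
    if "P \<in> positions prec h k" "next_pos h k P \<rho>' mv = Some P'" for P P' \<rho>' mv
    using R that unfolding ranking_def lt_def by blast
  have less: "(indic r (H \<union> L'), indic r (insert m (H \<union> L))) \<in> oexp (natLeq_on 2) r - Id"
    if "finite H" "finite L" "finite L'" "lt z m" "m \<notin> H" "\<And>x. x \<in> L \<union> L' \<Longrightarrow> lt x m" for H L L' m z
    using indic_less[OF lin that(1-3) lt_field(2)[OF that(4)] that(5)] that(6) by (simp add: lt_def)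
  have seq: "\<exists>Ps. P = Seq Ps \<and> Ps \<noteq> [] \<and> set Ps \<subseteq> positions prec h k \<and>
      sorted_wrt (\<lambda>P P'. lt (\<Phi> P' 1) (\<Phi> P 0)) Ps" if "P \<in> positions prec h (Suc k)" for P
    using positions_SucE[OF that k] ranking_plays_sorted[OF R k] sorted_wrt_subseq
    unfolding lt_def[symmetric] by (metis subsetI)
  have lo_set: "lt (lo i) x" if P: "P \<in> positions prec h (Suc k)" and x: "x \<in> last_set \<Phi> P" for P x i
  proof -
    obtain Ps where "P = Seq Ps" "Ps \<noteq> []" "set Ps \<subseteq> positions prec h k" using seq[OF P] by blast
    then show ?thesis using x lo_lt last_in_set[of Ps] by (auto simp: last_set_def subset_iff dest: in_set_butlastD)
  qed
  have fin: "finite (last_set \<Phi> P)" for P by (cases P) (auto simp: last_set_def)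
  have 1: "(indic r {lo i}, indic r {lo j}) \<in> oexp (natLeq_on 2) r - Id" if "i < j" for i j
    using less[of "{}" "{}" "{lo i}" "lo i" "lo j"] lo[OF that] by simp
  have 2: "(indic r {lo i}, indic r (last_set \<Phi> P \<union> {lo n})) \<in> oexp (natLeq_on 2) r - Id"
    if P: "P \<in> positions prec h (Suc k)" for P i n
  proof -
    have ne: "last_set \<Phi> P \<noteq> {}" using seq[OF P] by (auto simp: last_set_def)
    have "last_set \<Phi> P \<subseteq> Field r" using lo_set[OF P] lt_field by blast
    with ne obtain m where m: "m \<in> last_set \<Phi> P" "\<forall>x\<in>last_set \<Phi> P. (x, m) \<in> r"
      using finite_has_greatest[OF lin fin ne] by blast
    have "lt (lo i) m" for i using lo_set[OF P m(1)] .
    \<comment> \<open>No part is shared here, since \<open>lo i\<close> and \<open>lo n\<close> may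
      be in any order; the greatest rank \<open>m\<close> alone decides.\<close>
    moreover have "last_set \<Phi> P \<union> {lo n} = insert m ({} \<union> (last_set \<Phi> P - {m} \<union> {lo n}))"
      using m(1) by blast
    ultimately show ?thesis
      using less[of "{}" "(last_set \<Phi> P - {m}) \<union> {lo n}" "{lo i}" "lo i" m] fin m(2)
      by (auto simp: lt_def)
  qed
  have 3: "(indic r (last_set \<Phi> P \<union> {lo i}), indic r (last_set \<Phi> P \<union> {lo j})) \<in> oexp (natLeq_on 2) r - Id"
    if P: "P \<in> positions prec h (Suc k)" and "i < j" for P i j
    using less[of "last_set \<Phi> P" "{}" "{lo i}" "lo i" "lo j"] lo[OF that(2)] lo_set[OF P, of "lo j" j]
      lt_irrefl[of "lo j"] fin by auto
  have 4: "(indic r (last_set \<Phi> P' \<union> {lo i}), indic r (last_set \<Phi> P \<union> {lo j})) \<in> oexp (natLeq_on 2) r - Id"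
    if P: "P \<in> positions prec h (Suc k)" and nxt: "next_pos h (Suc k) P \<rho>' mv = Some P'" for P P' \<rho>' mv i j
  proof -
    obtain Ps where Ps: "P = Seq Ps" "Ps \<noteq> []" "set Ps \<subseteq> positions prec h k"
      "sorted_wrt (\<lambda>P P'. lt (\<Phi> P' 1) (\<Phi> P 0)) Ps" using seq[OF P] by blast
    from k nxt[unfolded Ps(1)] show ?thesis
    proof (cases rule: next_pos_Suc)
      case (extend X)
      obtain us Y where us: "Ps = us @ [Y]" using Ps(2) by (metis rev_exhaust)
      have Y: "Y \<in> positions prec h k" using Ps(3) us by simp
      have m: "\<Phi> Y 1 \<notin> (\<lambda>P. \<Phi> P 0) ` set us" using Ps(4) lt_irrefl unfolding us
        by (force simp: sorted_wrt_append)
      have "lt (\<Phi> X 1) (\<Phi> Y 0)" using nx[OF Y] extend(2) us by simp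
      then have L: "lt x (\<Phi> Y 1)" if "x \<in> {lo j} \<union> {\<Phi> Y 0, \<Phi> X 1, lo i}" for x
        using that lo_lt[OF Y] lt_trans by blast
      \<comment> \<open>The deciding rank is \<open>\<Phi> Y 1\<close>: it disappears when
        \<open>Y\<close> stops being the last entry, and everything new lies below it.\<close>
      have E: "last_set \<Phi> P' \<union> {lo i} = (\<lambda>P. \<Phi> P 0) ` set us \<union> {\<Phi> Y 0, \<Phi> X 1, lo i}"
        "last_set \<Phi> P \<union> {lo j} = insert (\<Phi> Y 1) ((\<lambda>P. \<Phi> P 0) ` set us \<union> {lo j})"
        unfolding extend(1) Ps(1) us last_set_snoc by auto
      show ?thesis unfolding E by (rule less[OF _ _ _ lo_lt(3)[OF Y] m]) (simp, simp, simp, rule L)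
    next
      case (backtrack b X)
      define us Y ws where "us = take b Ps" and "Y = Ps ! b" and "ws = drop (Suc b) Ps"
      have eq: "Ps = us @ Y # ws" using id_take_nth_drop[OF backtrack(1)] by (simp add: us_def Y_def ws_def)
      have Y: "Y \<in> positions prec h k" using Ps(3) eq by simp
      have X: "lt (\<Phi> X 1) (\<Phi> Y 0)" using nx[OF Y] backtrack(3) by (simp add: Y_def)
      have P': "last_set \<Phi> P' \<union> {lo i} = (\<lambda>P. \<Phi> P 0) ` set us \<union> {\<Phi> X 1, lo i}"
        unfolding backtrack(2) us_def[symmetric] last_set_snoc by auto
      let ?H = "(\<lambda>P. \<Phi> P 0) ` set us"
      have m1: "\<Phi> Y 1 \<notin> ?H" using Ps(4) lt_irrefl unfolding eq by (force simp: sorted_wrt_append)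
      have m0: "\<Phi> Y 0 \<notin> ?H"
      proof
        assume "\<Phi> Y 0 \<in> ?H"
        then have "lt (\<Phi> Y 1) (\<Phi> Y 0)" using Ps(4) unfolding eq by (auto simp: sorted_wrt_append)
        then show False using lt_trans lt_irrefl lo_lt(3)[OF Y] by blast
      qed
      \<comment> \<open>The deciding rank is the one under which \<open>Y\<close> is counted in
        \<open>P\<close>: \<open>\<Phi> Y 1\<close> if \<open>Y\<close> is the last entry,
        \<open>\<Phi> Y 0\<close> otherwise. The successor \<open>X\<close> lies below both.\<close>
      show ?thesis
      proof (cases "ws = []")
        case True
        have P: "last_set \<Phi> P \<union> {lo j} = insert (\<Phi> Y 1) (?H \<union> {lo j})"
          unfolding Ps(1) eq True last_set_snoc by auto
        have L: "lt x (\<Phi> Y 1)" if "x \<in> {lo j} \<union> {\<Phi> X 1, lo i}" for x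
          using that X lo_lt[OF Y] lt_trans by blast
        show ?thesis unfolding P P' by (rule less[OF _ _ _ lo_lt(3)[OF Y] m1]) (simp, simp, simp, rule L)
      next
        case False
        let ?L = "(\<lambda>P. \<Phi> P 0) ` set (butlast ws) \<union> {\<Phi> (last ws) 1, lo j}"
        have P: "last_set \<Phi> P \<union> {lo j} = insert (\<Phi> Y 0) (?H \<union> ?L)"
          using False by (auto simp: Ps(1) eq last_set_def butlast_append)
        have ws: "lt (\<Phi> Z 1) (\<Phi> Y 0)" "lt (\<Phi> Z 0) (\<Phi> Z 1)" if "Z \<in> set ws" for Z
          using that Ps(3,4) lo_lt(3) unfolding eq by (auto simp: sorted_wrt_append)
        have L: "lt x (\<Phi> Y 0)" if "x \<in> ?L \<union> {\<Phi> X 1, lo i}" for x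
          using that last_in_set[OF False] X lo_lt(1)[OF Y] ws(1) lt_trans[OF ws(2) ws(1)] False by (auto dest!: in_set_butlastD)
        show ?thesis unfolding P P' by (rule less[OF _ _ _ lo_lt(1)[OF Y] m0]) (simp, simp, simp, rule L)
      qed
    qed
  qed
  show ?thesis unfolding ranking_def
    by (intro conjI allI ballI impI Linear_order_oexp Linear_order_natLeq_on lin; (rule 1 2 3 4; assumption))
qed

section \<open>The strategy of Delayer\<close>

text \<open>Backtracking resumes from an entry other than the last, so the invariant must control
  every stored predicate and not just \<open>rho\<close>.\<close>

fun preds :: "position \<Rightarrow> partial_pred set" where
  "preds (Base T \<rho>) = {\<rho>}"
| "preds (Seq Ps) = (\<Union>P\<in>set Ps. preds P)"

lemma rho_in_preds: "k \<ge> 1 \<Longrightarrow> P \<in> positions prec h k \<Longrightarrow> rho P \<in> preds P"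
proof (induction k arbitrary: P rule: dec_induct)
  case base
  then show ?case by auto
next
  case (step k)
  from positions_SucE[OF step.prems step.hyps(1)] obtain Ps where "P = Seq Ps" "Ps \<noteq> []"
    "\<And>P. P \<in> set Ps \<Longrightarrow> P \<in> positions prec h k" by metis
  then show ?case using step.IH[of "last Ps"] by fastforce
qed

lemma preds_next_pos:
  "k \<ge> 1 \<Longrightarrow> P \<in> positions prec h k \<Longrightarrow> next_pos h k P \<rho>' mv = Some P' \<Longrightarrow>
    preds P' \<subseteq> preds P \<union> {\<sigma> ++ \<rho>' | \<sigma>. \<sigma> \<in> preds P}"
proof (induction k arbitrary: P P' mv rule: dec_induct)
  case base
  then show ?case by (cases mv) (auto simp: next_base_def Let_def split: if_splits)
next
  case (step k)
  from positions_SucE[OF step.prems(1) step.hyps(1)] obtain Ps where Ps: "P = Seq Ps" "Ps \<noteq> []"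
    "\<And>P. P \<in> set Ps \<Longrightarrow> P \<in> positions prec h k" by metis
  from step.hyps(1) step.prems(2)[unfolded Ps(1)] show ?case
  proof (cases rule: next_pos_Suc)
    case (extend R)
    have "last Ps \<in> set Ps" using Ps(2) by simp
    then show ?thesis using step.IH[OF Ps(3) extend(2)] by (fastforce simp: extend(1) Ps(1))
  next
    case (backtrack b R)
    have "Ps ! b \<in> set Ps" using backtrack(1) by simp
    then show ?thesis using step.IH[OF Ps(3) backtrack(3)] set_take_subset[of b Ps]
      by (fastforce simp: backtrack(2) Ps(1))
  qed
qed

lemma preds_init_pos: "k \<ge> 1 \<Longrightarrow> preds (init_pos k m) = {[m \<mapsto> True]}"
  by (induction k rule: dec_induct) auto

text \<open>Delayer's strategy only sees the history; on histories that belong to no run the result is junk.\<close>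

definition replay :: "nat \<Rightarrow> nat \<Rightarrow> nat \<Rightarrow> history \<Rightarrow> position" where
  "replay h k m hs = foldl (\<lambda>P (Q, \<rho>', mv). the (next_pos h k P \<rho>' mv)) (init_pos k m) hs"

lemma run_replay: "run h k m answ query pick n = Running hs P \<Longrightarrow> P = replay h k m hs"
proof (induction n arbitrary: hs P)
  case (Suc n)
  then obtain hs0 P0 where r: "run h k m answ query pick n = Running hs0 P0" by (auto split: status.splits)
  with Suc.prems Suc.IH[OF r] show ?case
    by (auto simp: Let_def replay_def split: if_splits option.splits)
qed (simp add: replay_def)

text \<open>Reduces strategies to single rounds: an answer depends on the position only, which the
  history determines. Descent in \<open>W\<close> rules out an endless play, and compatibility rules
  out a win of Prover.\<close>

lemma delayer_wins:
  assumes init: "I (init_pos k m)" and wf: "wf W"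
    and ans: "\<And>P Q. I P \<Longrightarrow> finite Q \<Longrightarrow> \<exists>\<rho>'. legal_answer prec Q \<rho>' \<and> compatible (rho P) \<rho>' \<and>
      (\<forall>mv P'. legal_move k mv \<longrightarrow> next_pos h k P \<rho>' mv = Some P' \<longrightarrow> I P' \<and> (P', P) \<in> W)"
  shows "\<exists>answ. delayer_winning_strategy prec h k m answ"
proof -
  obtain a where a: "\<And>P Q. I P \<Longrightarrow> finite Q \<Longrightarrow> legal_answer prec Q (a P Q) \<and> compatible (rho P) (a P Q) \<and>
      (\<forall>mv P'. legal_move k mv \<longrightarrow> next_pos h k P (a P Q) mv = Some P' \<longrightarrow> I P' \<and> (P', P) \<in> W)"
    using ans by metis
  \<comment> \<open>Off the invariant all queries get 0, which is legal since no value 1 asks for a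
    witness.\<close>
  define answ where "answ hs Q = (if I (replay h k m hs) then a (replay h k m hs) Q
    else (\<lambda>q. if q \<in> Q then Some False else None))" for hs Q
  have "delayer_strategy prec answ"
    unfolding delayer_strategy_def
  proof (intro allI impI)
    fix hs :: history and Q :: "nat set" assume "finite Q"
    then show "legal_answer prec Q (answ hs Q)"
      using a by (auto simp: answ_def legal_answer_def dom_def)
  qed
  moreover have "\<exists>n. run h k m answ query pick n = Delayer_Won" if prov: "prover_strategy k query pick" for query pick
  proof -
    have "run h k m answ query pick n = Running hs P \<Longrightarrow> I P \<Longrightarrow> \<exists>n. run h k m answ query pick n = Delayer_Won"
      for n hs P
    proof (induction P arbitrary: n hs rule: wf_induct_rule[OF wf])
      case (1 P)
      have P: "P = replay h k m hs" using run_replay[OF 1(2)] .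
      define Q where "Q = query m hs"
      define \<rho>' where "\<rho>' = a P Q"
      define mv where "mv = pick m hs \<rho>'"
      have fin: "finite Q" "legal_move k mv" using prov by (auto simp: prover_strategy_def Q_def mv_def)
      have "answ hs Q = \<rho>'" using 1(3) by (simp add: answ_def \<rho>'_def P)
      then have nxt: "run h k m answ query pick (Suc n) = (case next_pos h k P \<rho>' mv of
          None \<Rightarrow> Delayer_Won | Some P' \<Rightarrow> Running (hs @ [(Q, \<rho>', mv)]) P')"
        using a[OF 1(3) fin(1)] 1(2) unfolding mv_def \<rho>'_def Q_def by (simp add: Let_def split: option.split)
      show ?case
      proof (cases "next_pos h k P \<rho>' mv")
        case None
        then show ?thesis using nxt by (auto intro: exI[of _ "Suc n"])
      next
        case (Some P')
        then have "I P' \<and> (P', P) \<in> W" using a[OF 1(3) fin(1)] fin(2) unfolding \<rho>'_def by blast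
        then show ?thesis using 1(1)[of P' "Suc n"] nxt Some by simp
      qed
    qed
    from this[of 0] show ?thesis using init by simp
  qed
  ultimately show ?thesis unfolding delayer_winning_strategy_def by blast
qed

text \<open>Delayer repeats known values, answers 0 to new queries and adds an unused number of the block of
  the current position, on which the predicate is 1. It lies below every number which any
  recorded predicate maps to 1, and above the blocks of all later positions. This covers
  backtracking as well, since it only joins the answer to predicates recorded earlier.\<close>

lemma delayer_wins_by_rank:
  fixes \<Psi> :: "position \<Rightarrow> nat \<Rightarrow> nat"
  assumes wo: "well_order_on UNIV prec" and k: "k \<ge> 1"
    and top: "\<And>P n. P \<in> positions prec h k \<Longrightarrow> (\<Psi> P n, m) \<in> prec - Id"
    and inc: "\<And>P i j. P \<in> positions prec h k \<Longrightarrow> i < j \<Longrightarrow> (\<Psi> P i, \<Psi> P j) \<in> prec - Id"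
    and dec: "\<And>P \<rho>' mv P' i j. P \<in> positions prec h k \<Longrightarrow> next_pos h k P \<rho>' mv = Some P' \<Longrightarrow>
      (\<Psi> P' i, \<Psi> P j) \<in> prec - Id"
  shows "\<exists>answ. delayer_winning_strategy prec h k m answ"
proof -
  have Field: "Field prec = UNIV" using wo well_order_on_Well_order by blast
  have lin: "Linear_order prec" using wo unfolding Field by (simp add: well_order_on_def)
  note tr = transD[OF trans_strict[OF lin]]
  define I where "I P \<longleftrightarrow> (\<exists>ps\<in>plays prec h k. last ps = P) \<and> finite (dom (rho P)) \<and>
    (\<forall>\<sigma>\<in>preds P. finite (dom \<sigma>) \<and> (\<forall>x n. \<sigma> x = Some True \<longrightarrow> (\<Psi> P n, x) \<in> prec - Id))" for P
  have pos: "P \<in> positions prec h k" if "I P" for P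
    using that plays_positions k unfolding I_def by blast
  show ?thesis
  proof (rule delayer_wins[where I = I and W = "inv_image (prec - Id) (\<lambda>P. \<Psi> P 0)"])
    have p: "[init_pos k m] \<in> plays prec h k" by (rule plays.init)
    have q: "init_pos k m \<in> positions prec h k" using plays_positions[OF p k] by simp
    show "I (init_pos k m)"
      using rho_in_preds[OF k q] top[OF q] by (auto simp: I_def preds_init_pos[OF k] intro!: bexI[OF _ p])
    show "wf (inv_image (prec - Id) (\<lambda>P. \<Psi> P 0))"
      using wo by (simp add: well_order_on_def)
    fix P and Q :: "nat set" assume P: "I P" and Q: "finite Q"
    have Ppos: "P \<in> positions prec h k" using pos[OF P] .
    note rP = rho_in_preds[OF k Ppos]
    have "inj (\<Psi> P)" using inc[OF Ppos] by (intro linorder_injI) auto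
    then have "infinite (range (\<Psi> P))" using finite_imageD by blast
    moreover have "finite (Q \<union> dom (rho P))" using P Q by (simp add: I_def)
    ultimately obtain n where n: "\<Psi> P n \<notin> Q \<union> dom (rho P)" by (meson finite_subset image_subsetI)
    define \<rho>' where "\<rho>' q = (if q = \<Psi> P n then Some True
      else if q \<in> Q then (case rho P q of None \<Rightarrow> Some False | Some v \<Rightarrow> Some v) else None)" for q
    have true: "x = \<Psi> P n \<or> rho P x = Some True" if "\<rho>' x = Some True" for x
      using that by (auto simp: \<rho>'_def split: if_splits option.splits)
    have fin: "finite (dom \<rho>')"
      by (rule finite_subset[of _ "insert (\<Psi> P n) Q"]) (use Q in \<open>auto simp: \<rho>'_def split: if_splits\<close>)
    have leg: "legal_answer prec Q \<rho>'" unfolding legal_answer_def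
    proof (intro conjI ballI impI fin)
      show "Q \<subseteq> dom \<rho>'" by (auto simp: \<rho>'_def split: option.splits)
      \<comment> \<open>The fresh number \<open>\<Psi> P n\<close> avoids \<open>Q\<close>, so it
        needs no witness itself; a queried number with value 1 had this value before.\<close>
      fix q assume "q \<in> Q" "\<rho>' q = Some True"
      then have "rho P q = Some True" using true n by blast
      then have "(\<Psi> P n, q) \<in> prec - Id" using P rP unfolding I_def by blast
      then show "\<exists>p. (p, q) \<in> prec \<and> p \<noteq> q \<and> \<rho>' p = Some True" by (auto simp: \<rho>'_def)
    qed
    \<comment> \<open>Compatibility with the current predicate suffices: a clash with an older one
      on backtracking leaves no next position, and then Delayer wins.\<close>
    have comp: "compatible (rho P) \<rho>'"
      using n by (auto simp: compatible_def \<rho>'_def split: if_splits)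
    have "I P' \<and> (P', P) \<in> inv_image (prec - Id) (\<lambda>P. \<Psi> P 0)"
      if mv: "legal_move k mv" and nxt: "next_pos h k P \<rho>' mv = Some P'" for mv P'
    proof -
      obtain ps where ps: "ps \<in> plays prec h k" "last ps = P" using P by (auto simp: I_def)
      have ps': "ps @ [P'] \<in> plays prec h k"
        using plays.step[OF ps(1) Q leg _ mv] comp nxt ps(2) by simp
      have old: "finite (dom \<sigma>) \<and> (\<forall>x. \<sigma> x = Some True \<longrightarrow> (\<Psi> P' i, x) \<in> prec - Id)"
        if "\<sigma> \<in> preds P" for \<sigma> i
        using P that tr[OF dec[OF Ppos nxt]] unfolding I_def by blast
      have new: "(\<Psi> P' i, x) \<in> prec - Id" if "\<rho>' x = Some True" for x i
        using true[OF that] dec[OF Ppos nxt] old[OF rP] by blast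
      have "finite (dom \<sigma>) \<and> (\<forall>x. \<sigma> x = Some True \<longrightarrow> (\<Psi> P' i, x) \<in> prec - Id)"
        if \<sigma>: "\<sigma> \<in> preds P'" for \<sigma> i
      proof -
        consider "\<sigma> \<in> preds P" | \<tau> where "\<tau> \<in> preds P" "\<sigma> = \<tau> ++ \<rho>'"
          using preds_next_pos[OF k Ppos nxt] \<sigma> by blast
        then show ?thesis
        proof cases
          case 2
          then show ?thesis using old[OF 2(1)] new fin unfolding 2(2) map_add_Some_iff dom_map_add by blast
        qed (rule old)
      qed
      moreover have "rho P' \<in> preds P'"
        using rho_in_preds[OF k] plays_positions[OF ps' k] by simp
      moreover have "\<exists>qs\<in>plays prec h k. last qs = P'" using ps' by force
      ultimately have "I P'" unfolding I_def by blast
      then show ?thesis using dec[OF Ppos nxt] by simp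
    qed
    then show "\<exists>\<rho>'. legal_answer prec Q \<rho>' \<and> compatible (rho P) \<rho>' \<and>
      (\<forall>mv P'. legal_move k mv \<longrightarrow> next_pos h k P \<rho>' mv = Some P' \<longrightarrow>
        I P' \<and> (P', P) \<in> inv_image (prec - Id) (\<lambda>P. \<Psi> P 0))"
      using leg comp by blast
  qed
qed

section \<open>Iteration along the tower and transfer into the given well-order\<close>

text \<open>The comb ranks provide two ranks per position. Each exponential turns two into
  infinitely many, of which the next one again takes two.\<close>

lemma ranking_tower:
  assumes "h > 0"
  defines "r \<equiv> on_nat (oexp natLeq (natLeq_on (h + 1)))"
  shows "\<exists>\<Phi> lo. ranking prec h (Suc k) (if k = 0 then {0, 1} else UNIV) (tower k r) \<Phi> lo"
proof (induction k)
  case 0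
  have "countable (Field (oexp natLeq (natLeq_on (h + 1))))"
    unfolding Field_oexp by (intro countable_fin_supp_funcs) auto
  from ranking_on_nat[OF ranking_base[OF assms(1)] this] show ?case by (simp add: r_def)
next
  case (Suc k)
  then obtain \<Phi> lo where "ranking prec h (Suc k) (if k = 0 then {0, 1} else UNIV) (tower k r) \<Phi> lo"
    by blast
  then have "ranking prec h (Suc k) {0, 1} (tower k r) \<Phi> lo"
    by (rule ranking_subset) auto
  from ranking_Suc[OF this] have "\<exists>\<Phi> lo. ranking prec h (Suc (Suc k)) UNIV (oexp (natLeq_on 2) (tower k r)) \<Phi> lo"
    by auto
  moreover have "countable (Field (oexp (natLeq_on 2) (tower k r)))"
    unfolding Field_oexp by (intro countable_fin_supp_funcs) auto
  ultimately show ?case using ranking_on_nat by fastforce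
qed

theorem proposition4p7:
  fixes prec :: "nat rel" and k h :: nat
  assumes "well_order_on UNIV prec"
    and "k \<ge> 1"
    and "h > 0"
    and "osum (oprod (tower k (on_nat (oexp natLeq (natLeq_on (h + 1))))) (natLeq_on 2)) natLeq <o prec"
  shows "\<exists>m answ. delayer_winning_strategy prec h (k + 1) m answ"
proof -
  define r where "r = tower k (on_nat (oexp natLeq (natLeq_on (h + 1))))"
  define R where "R = osum (oprod r (natLeq_on 2)) natLeq"
  obtain \<Phi> lo where "ranking prec h (Suc k) UNIV r \<Phi> lo"
    using ranking_tower[OF assms(3), of prec k] assms(2) unfolding r_def by auto
  note rank = this[unfolded ranking_def]
  have inc: "(\<Phi> P i, \<Phi> P j) \<in> r - Id" if "P \<in> positions prec h (Suc k)" "i < j" for P i j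
    using rank that by blast
  have dec: "(\<Phi> P' i, \<Phi> P j) \<in> r - Id"
      if "P \<in> positions prec h (Suc k)" "next_pos h (Suc k) P \<rho>' mv = Some P'" for P \<rho>' mv P' i j
    using rank that by blast
  obtain f where wo: "Well_order R" and f: "embed R prec f"
    using assms(4) unfolding r_def[symmetric] R_def[symmetric] ordLess_def embedS_def by auto
  have f_less: "(f x, f y) \<in> prec - Id" if "(x, y) \<in> R - Id" for x y
    using that embed_compat[OF f] embed_inj_on[OF wo f] FieldI1[of x y R] FieldI2[of x y R]
    by (auto simp: compat_def inj_on_def)
  \<comment> \<open>The blocks go into the lower copy of \<open>r\<close>, tagged 0. Delayer's
    initial number is the image of \<open>Inr 0\<close>, the first point after both copies, hence
    above all blocks.\<close>
  define \<Psi> where "\<Psi> P n = f (Inl (\<Phi> P n, 0))" for P n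
  have \<Psi>: "(\<Psi> P n, \<Psi> P' n') \<in> prec - Id" if "(\<Phi> P n, \<Phi> P' n') \<in> r - Id" for P n P' n'
    unfolding \<Psi>_def using that
    by (intro f_less) (auto simp: R_def osum_def oprod_def Field_natLeq_on intro: FieldI1 FieldI2)
  have "\<exists>answ. delayer_winning_strategy prec h (Suc k) (f (Inr 0)) answ"
  proof (rule delayer_wins_by_rank[OF assms(1), where \<Psi> = \<Psi>])
    fix P n assume P: "P \<in> positions prec h (Suc k)"
    have "\<Phi> P n \<in> Field r" using inc[OF P lessI] by (auto intro: FieldI1)
    then have "((\<Phi> P n, 0), (\<Phi> P (Suc n), 0)) \<in> oprod r (natLeq_on 2)"
      using inc[OF P lessI] by (auto simp: oprod_def Field_natLeq_on intro: FieldI2)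
    then have "(\<Phi> P n, 0) \<in> Field (oprod r (natLeq_on 2))" by (rule FieldI1)
    then show "(\<Psi> P n, f (Inr 0)) \<in> prec - Id"
      unfolding \<Psi>_def by (intro f_less) (simp add: R_def osum_def Field_natLeq)
  qed (simp, (rule \<Psi>, rule inc, assumption+), (rule \<Psi>, rule dec, assumption+))
  then show ?thesis by auto
qed

end
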